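(* Let $A_1,A_2\in\mathbb{R}^{2\times2}$ be such that $P_0=\mathbb{R}^2$, $P_1=(A_1+iI)\mathbb{R}^2$, $P_2=(A_2+iI)\mathbb{R}^2$ are maximal totally real subspaces of $\mathbb{C}^2$. Suppose that the union of any two of $P_0,P_1,P_2$ is locally polynomially convex at the origin, that $\det[A_1,A_2]<0$, and that $\det A_j<0$ for $j=1,2$. Then $P_0\cup P_1\cup P_2$ is locally polynomially convex at the origin.
   Context: A maximal totally real subspace of $\mathbb{C}^2$ is a real-linear subspace $P$ of real dimension $2$ with $P\cap iP=\{0\}$. $[A_1,A_2]=A_1A_2-A_2A_1$. A compact set $K\subset\mathbb{C}^2$ is polynomially convex if $K=\{z\in\mathbb{C}^2:|p(z)|\le\sup_K|p|\ \ \forall p\in\mathbb{C}[z_1,z_2]\}$. A closed set $S$ is locally polynomially convex at $a\in S$ if $S\cap\overline{B(a,r)}$ is polynomially convex for some $r>0$. *)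

theory Defs
  imports "HOL-Analysis.Analysis" "HOL-Computational_Algebra.Polynomial"
begin

(* A polynomial in C[z1,z2] is represented as an element of C[z1][z2]:
   the outer variable is z2, the coefficients are polynomials in z1. *)
definition poly_eval2 :: "complex poly poly \<Rightarrow> complex ^ 2 \<Rightarrow> complex" where
  "poly_eval2 p z = poly (poly p [:z $ 2:]) (z $ 1)"

(* The supremum is a real one, so it has its intended meaning for nonempty compact K only;
   for K = {} it is the unspecified real number Sup {}. *)
definition polynomially_convex :: "(complex ^ 2) set \<Rightarrow> bool" where
  "polynomially_convex K \<longleftrightarrow> compact K \<and>
     K = {z. \<forall>p. norm (poly_eval2 p z) \<le> (SUP w\<in>K. norm (poly_eval2 p w))}"

(* Since a belongs to S, the intersection with a closed ball about a is never empty. *)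
definition locally_polynomially_convex_at :: "(complex ^ 2) set \<Rightarrow> complex ^ 2 \<Rightarrow> bool" where
  "locally_polynomially_convex_at S a \<longleftrightarrow> closed S \<and> a \<in> S \<and>
     (\<exists>r>0. polynomially_convex (S \<inter> cball a r))"

(* subspace and dim refer to the real vector space structure of complex ^ 2. *)
definition maximal_totally_real :: "(complex ^ 2) set \<Rightarrow> bool" where
  "maximal_totally_real P \<longleftrightarrow> subspace P \<and> dim P = 2 \<and> P \<inter> (*s) \<i> ` P = {0}"

definition real_plane :: "(complex ^ 2) set" where
  "real_plane = {z. \<forall>j. z $ j \<in> \<real>}"

(* The set (A + iI) R^2; mat c is the scalar matrix cI. *)
definition graph_plane :: "real ^ 2 ^ 2 \<Rightarrow> (complex ^ 2) set" where
  "graph_plane A = (*v) (map_matrix complex_of_real A + mat \<i>) ` real_plane"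

end

theory Submission
  imports Defs
begin

text \<open>Let \<open>C\<close> be the commutator of \<open>A1\<close> and \<open>A2\<close>, and let \<open>J\<close> be the rotation of the plane with
  rows \<open>(0, 1)\<close> and \<open>(-1, 0)\<close>.  Since \<open>C\<close> has trace zero, \<open>S = J C\<close> is symmetric, with
  \<open>det S = det C < 0\<close>; since \<open>C A1\<close> and \<open>C A2\<close> have trace zero, \<open>S A1\<close> and \<open>S A2\<close> are symmetric
  too.  On the plane \<open>(A + i I) x\<close> with \<open>S A\<close> symmetric, the quadratic polynomial
  \<open>p(z) = z\<^sup>T S z\<close> has imaginary part \<open>2 x\<^sup>T S A x\<close>.  For \<open>A = A1\<close> and \<open>A = A2\<close> this form is definite,
  because \<open>det (S A) = det S det A > 0\<close>.  Hence \<open>p\<close> is real on \<open>P0\<close>, while on \<open>P1 \<union> P2\<close> its values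
  lie in a double sector \<open>\<bar>Im p\<bar> \<ge> c \<bar>p\<bar>\<close> around the imaginary axis, and \<open>p\<close> vanishes there only at
  the origin.  The sets \<open>X1 = P0 \<inter> B\<close> and \<open>X2 = (P1 \<union> P2) \<inter> B\<close>, for a suitable closed ball \<open>B\<close>
  about the origin, are polynomially convex: the first by means of Gaussians
  (\<open>polynomial_hull_real_disc\<close>), the second by hypothesis.  The form of Kallin's lemma in
  \<open>Kallin_real_axis\<close> then gives polynomial convexity of \<open>X1 \<union> X2\<close>.

  Kallin's lemma is proved by constructing explicit uniform limits of polynomials.  Suppose that
  \<open>z\<close> lies in the hull of \<open>X1 \<union> X2\<close>, that \<open>f\<close> is a polynomial with \<open>\<bar>f\<bar> \<le> d\<close> on \<open>X1\<close> and
  \<open>\<bar>f z\<bar> > d\<close>, and that there are uniform limits \<open>F\<close> of polynomials which are bounded by a fixed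
  constant on \<open>X1\<close>, arbitrarily small on \<open>X2\<close>, and not small at \<open>z\<close>.  Then \<open>F f\<^sup>k\<close>, with first \<open>k\<close>
  large and then \<open>F\<close> small enough on \<open>X2\<close>, is larger at \<open>z\<close> than anywhere on \<open>X1 \<union> X2\<close>, which is
  impossible (\<open>polynomial_hull_localize\<close>).  So such an \<open>F\<close> puts \<open>z\<close> into the hull of \<open>X1\<close> alone,
  and with the roles exchanged into the hull of \<open>X2\<close>.

  The functions \<open>F\<close> are functions of \<open>q = p\<^sup>2\<close>, which maps \<open>X1\<close> into the ray \<open>[0, \<infinity>)\<close> and \<open>X2\<close> into a
  sector \<open>2 \<alpha> \<le> arg \<le> 2 \<pi> - 2 \<alpha>\<close>.  The rays of argument \<open>\<alpha>\<close> and \<open>-\<alpha>\<close> separate the two, and for a point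
  \<open>c\<close> on one of them the functions \<open>1 / (1 - q / c)\<close> and \<open>Ln (1 - q / c)\<close> are uniform limits of
  polynomials: they are reached from \<open>c = \<infinity>\<close> by finitely many short moves of the pole or branch
  point along the ray (\<open>polynomial_limits_Ln\<close>).  Suitably normalised, the difference of the two
  logarithms whose branch points have modulus \<open>\<eta>\<close> and arguments \<open>\<plusminus>\<alpha>\<close> tends as \<open>\<eta> \<rightarrow> 0\<close> to \<open>1\<close> on
  the open ray and to \<open>0\<close> on the sector without its vertex (\<open>transition_asymptotics\<close>); a factor
  that vanishes where \<open>q = 0\<close> controls it near that vertex.
  This settles the points \<open>z\<close> with \<open>q z \<noteq> 0\<close>.  If \<open>q z = 0\<close>, the functions \<open>1 / (1 - q / c)\<close> with
  small \<open>c\<close>, which peak where \<open>q = 0\<close>, do the same service.\<close>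

section \<open>Polynomials in two variables and polynomial hulls\<close>

lemma poly_eval2_add: "poly_eval2 (p + q) z = poly_eval2 p z + poly_eval2 q z"
  and poly_eval2_mult: "poly_eval2 (p * q) z = poly_eval2 p z * poly_eval2 q z"
  and poly_eval2_const: "poly_eval2 [:[:a:]:] z = a"
  and poly_eval2_fst: "poly_eval2 [:[:0, 1:]:] z = z $ 1"
  and poly_eval2_snd: "poly_eval2 [:0, 1:] z = z $ 2"
  by (simp_all add: poly_eval2_def)

lemma poly_eval2_power: "poly_eval2 (p ^ n) z = poly_eval2 p z ^ n"
  by (simp add: poly_eval2_def)

lemma continuous_on_poly_eval2: "continuous_on S (poly_eval2 p)"
proof (induction p)
  case 0
  then show ?case by (simp add: poly_eval2_def)
next
  case (pCons a p)
  have "poly_eval2 (pCons a p) = (\<lambda>z. poly a (z $ 1) + z $ 2 * poly_eval2 p z)"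
    by (simp add: poly_eval2_def fun_eq_iff)
  then show ?case
    using pCons by (auto intro!: continuous_intros)
qed

lemma poly_eval2_bounded_on_compact:
  assumes "compact X"
  obtains B where "B > 0" "\<And>x. x \<in> X \<Longrightarrow> norm (poly_eval2 p x) \<le> B"
proof -
  have "bounded (poly_eval2 p ` X)"
    by (intro compact_imp_bounded compact_continuous_image continuous_on_poly_eval2 assms)
  then show ?thesis
    using that unfolding bounded_pos by blast
qed

text \<open>Bounding the supremum from above by an arbitrary \<open>d\<close> keeps the definition meaningful for
  the empty set, whose hull is empty.\<close>

definition polynomial_hull :: "(complex ^ 2) set \<Rightarrow> (complex ^ 2) set" where
  "polynomial_hull X =
     {z. \<forall>p d. (\<forall>w\<in>X. norm (poly_eval2 p w) \<le> d) \<longrightarrow> norm (poly_eval2 p z) \<le> d}"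

lemma polynomially_convex_iff:
  assumes "X \<noteq> {}"
  shows "polynomially_convex X \<longleftrightarrow> compact X \<and> polynomial_hull X \<subseteq> X"
proof -
  have "{z. \<forall>p. norm (poly_eval2 p z) \<le> (SUP w\<in>X. norm (poly_eval2 p w))} = polynomial_hull X"
    if "compact X"
  proof -
    have "norm (poly_eval2 p w) \<le> (SUP w\<in>X. norm (poly_eval2 p w))" if "w \<in> X" for p w
    proof (rule cSUP_upper[OF that])
      obtain B where "\<And>x. x \<in> X \<Longrightarrow> norm (poly_eval2 p x) \<le> B"
        using poly_eval2_bounded_on_compact[OF \<open>compact X\<close>] by metis
      then show "bdd_above ((\<lambda>w. norm (poly_eval2 p w)) ` X)"
        by (intro bdd_aboveI2)
    qed
    moreover have "(SUP w\<in>X. norm (poly_eval2 p w)) \<le> d"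
      if "\<forall>w\<in>X. norm (poly_eval2 p w) \<le> d" for p d
      using that assms by (intro cSUP_least) auto
    ultimately show ?thesis
      unfolding polynomial_hull_def by (blast intro: order_trans)
  qed
  moreover have "X \<subseteq> polynomial_hull X"
    by (auto simp: polynomial_hull_def)
  ultimately show ?thesis
    unfolding polynomially_convex_def by blast
qed

section \<open>Uniform limits of polynomials\<close>

definition polynomial_limits :: "(complex ^ 2) set \<Rightarrow> (complex ^ 2 \<Rightarrow> complex) set" where
  "polynomial_limits Y = {F. \<forall>e>0. \<exists>p. \<forall>x\<in>Y. norm (F x - poly_eval2 p x) \<le> e}"

lemma polynomial_limitsE:
  assumes "F \<in> polynomial_limits Y" "e > 0"
  obtains p where "\<And>x. x \<in> Y \<Longrightarrow> norm (F x - poly_eval2 p x) \<le> e"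
  using assms unfolding polynomial_limits_def by blast

lemma polynomial_limits_bounded:
  assumes "compact Y" "F \<in> polynomial_limits Y"
  obtains B where "B > 0" "\<And>x. x \<in> Y \<Longrightarrow> norm (F x) \<le> B"
proof -
  obtain p where p: "\<And>x. x \<in> Y \<Longrightarrow> norm (F x - poly_eval2 p x) \<le> 1"
    using polynomial_limitsE[OF assms(2), of 1] by auto
  obtain B where B: "B > 0" "\<And>x. x \<in> Y \<Longrightarrow> norm (poly_eval2 p x) \<le> B"
    using poly_eval2_bounded_on_compact[OF assms(1)] by metis
  have "norm (F x) \<le> 1 + B" if "x \<in> Y" for x
    using p[OF that] B(2)[OF that] norm_triangle_ineq[of "F x - poly_eval2 p x" "poly_eval2 p x"] by simp
  with B(1) show ?thesis
    by (intro that[of "1 + B"]) auto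
qed

lemma polynomial_limits_poly: "poly_eval2 p \<in> polynomial_limits Y"
  unfolding polynomial_limits_def by (auto intro!: exI[of _ p])

lemma polynomial_limits_const: "(\<lambda>x. a) \<in> polynomial_limits Y"
  using polynomial_limits_poly[of "[:[:a:]:]" Y] by (simp add: poly_eval2_const[abs_def])

lemma polynomial_limits_limit:
  assumes "\<And>e. e > 0 \<Longrightarrow> \<exists>G\<in>polynomial_limits Y. \<forall>x\<in>Y. norm (F x - G x) \<le> e"
  shows "F \<in> polynomial_limits Y"
  unfolding polynomial_limits_def
proof (intro CollectI allI impI)
  fix e :: real assume "e > 0"
  obtain G where G: "G \<in> polynomial_limits Y" "\<forall>x\<in>Y. norm (F x - G x) \<le> e/2"
    using assms[of "e/2"] \<open>e > 0\<close> by auto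
  obtain p where p: "\<And>x. x \<in> Y \<Longrightarrow> norm (G x - poly_eval2 p x) \<le> e/2"
    using polynomial_limitsE[OF G(1), of "e/2"] \<open>e > 0\<close> by auto
  have "norm (F x - poly_eval2 p x) \<le> e" if "x \<in> Y" for x
  proof -
    have "norm (F x - poly_eval2 p x) \<le> norm (F x - G x) + norm (G x - poly_eval2 p x)"
      using norm_triangle_ineq[of "F x - G x" "G x - poly_eval2 p x"] by simp
    then show ?thesis
      using G(2) p[OF that] that by fastforce
  qed
  then show "\<exists>p. \<forall>x\<in>Y. norm (F x - poly_eval2 p x) \<le> e" by blast
qed

lemma polynomial_limits_cong:
  assumes "F \<in> polynomial_limits Y" "\<And>x. x \<in> Y \<Longrightarrow> F x = G x"
  shows "G \<in> polynomial_limits Y"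
  using assms unfolding polynomial_limits_def by simp

lemma polynomial_limits_add:
  assumes "F \<in> polynomial_limits Y" "G \<in> polynomial_limits Y"
  shows "(\<lambda>x. F x + G x) \<in> polynomial_limits Y"
  unfolding polynomial_limits_def
proof (intro CollectI allI impI)
  fix e :: real assume "e > 0"
  obtain p where p: "\<And>x. x \<in> Y \<Longrightarrow> norm (F x - poly_eval2 p x) \<le> e/2"
    using polynomial_limitsE[OF assms(1), of "e/2"] \<open>e > 0\<close> by auto
  obtain q where q: "\<And>x. x \<in> Y \<Longrightarrow> norm (G x - poly_eval2 q x) \<le> e/2"
    using polynomial_limitsE[OF assms(2), of "e/2"] \<open>e > 0\<close> by auto
  have "norm (F x + G x - poly_eval2 (p + q) x) \<le> e" if "x \<in> Y" for x
    using p[OF that] q[OF that] norm_triangle_ineq[of "F x - poly_eval2 p x" "G x - poly_eval2 q x"]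
    by (simp add: poly_eval2_add algebra_simps)
  then show "\<exists>p. \<forall>x\<in>Y. norm (F x + G x - poly_eval2 p x) \<le> e" by blast
qed

lemma polynomial_limits_mult:
  assumes "compact Y" "F \<in> polynomial_limits Y" "G \<in> polynomial_limits Y"
  shows "(\<lambda>x. F x * G x) \<in> polynomial_limits Y"
  unfolding polynomial_limits_def
proof (intro CollectI allI impI)
  fix e :: real assume "e > 0"
  obtain B where B: "B > 0" "\<And>x. x \<in> Y \<Longrightarrow> norm (G x) \<le> B"
    using polynomial_limits_bounded[OF assms(1,3)] by metis
  have "e / (2 * B) > 0" using \<open>e > 0\<close> B by simp
  then obtain p where p: "\<And>x. x \<in> Y \<Longrightarrow> norm (F x - poly_eval2 p x) \<le> e / (2 * B)"
    using polynomial_limitsE[OF assms(2)] by blast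
  obtain D where D: "D > 0" "\<And>x. x \<in> Y \<Longrightarrow> norm (poly_eval2 p x) \<le> D"
    using poly_eval2_bounded_on_compact[OF assms(1)] by metis
  have "e / (2 * D) > 0" using \<open>e > 0\<close> D by simp
  then obtain q where q: "\<And>x. x \<in> Y \<Longrightarrow> norm (G x - poly_eval2 q x) \<le> e / (2 * D)"
    using polynomial_limitsE[OF assms(3)] by blast
  have "norm (F x * G x - poly_eval2 (p * q) x) \<le> e" if "x \<in> Y" for x
  proof -
    have "F x * G x - poly_eval2 (p * q) x
        = (F x - poly_eval2 p x) * G x + poly_eval2 p x * (G x - poly_eval2 q x)"
      by (simp add: poly_eval2_mult algebra_simps)
    also have "norm \<dots> \<le> norm (F x - poly_eval2 p x) * norm (G x)
        + norm (poly_eval2 p x) * norm (G x - poly_eval2 q x)"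
      by (metis norm_mult norm_triangle_ineq)
    also have "\<dots> \<le> e / (2 * B) * B + D * (e / (2 * D))"
      using p[OF that] q[OF that] B(2)[OF that] D(2)[OF that] B(1) D(1) \<open>e > 0\<close>
      by (intro add_mono mult_mono) auto
    also have "\<dots> = e" using B D by simp
    finally show ?thesis .
  qed
  then show "\<exists>p. \<forall>x\<in>Y. norm (F x * G x - poly_eval2 p x) \<le> e" by blast
qed

lemma polynomial_limits_cmult:
  assumes "F \<in> polynomial_limits Y" "compact Y"
  shows "(\<lambda>x. a * F x) \<in> polynomial_limits Y"
  using polynomial_limits_mult[OF assms(2) polynomial_limits_const assms(1)] .

lemma polynomial_limits_diff:
  assumes "compact Y" "F \<in> polynomial_limits Y" "G \<in> polynomial_limits Y"
  shows "(\<lambda>x. F x - G x) \<in> polynomial_limits Y"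
  using polynomial_limits_add[OF assms(2) polynomial_limits_cmult[OF assms(3,1), of "-1"]] by simp

lemma polynomial_limits_power:
  assumes "compact Y" "F \<in> polynomial_limits Y"
  shows "(\<lambda>x. F x ^ n) \<in> polynomial_limits Y"
  by (induction n) (auto intro: polynomial_limits_const polynomial_limits_mult assms)

lemma polynomial_limits_sum:
  assumes "\<And>i. i \<in> I \<Longrightarrow> F i \<in> polynomial_limits Y"
  shows "(\<lambda>x. \<Sum>i\<in>I. F i x) \<in> polynomial_limits Y"
  using assms
  by (induction I rule: infinite_finite_induct)
     (auto intro: polynomial_limits_const polynomial_limits_add)

text \<open>A holomorphic function of \<open>F\<close> is again a limit of polynomials as long as the values of \<open>F\<close> stay
  inside its disc of convergence.\<close>

lemma polynomial_limits_power_series: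
  assumes "compact Y" and F: "F \<in> polynomial_limits Y" and r: "\<And>x. x \<in> Y \<Longrightarrow> norm (F x) \<le> r"
    and a: "summable (\<lambda>n. norm (a n) * r ^ n)"
    and g: "\<And>x. x \<in> Y \<Longrightarrow> (\<lambda>n. a n * F x ^ n) sums g x"
  shows "g \<in> polynomial_limits Y"
proof (rule polynomial_limits_limit)
  fix e :: real assume "e > 0"
  have "uniform_limit Y (\<lambda>n x. \<Sum>i<n. a i * F x ^ i) (\<lambda>x. \<Sum>i. a i * F x ^ i) sequentially"
  proof (rule Weierstrass_m_test[OF _ a])
    show "norm (a n * F x ^ n) \<le> norm (a n) * r ^ n" if "x \<in> Y" for n x
      using r[OF that] by (simp add: norm_mult norm_power mult_left_mono power_mono)
  qed
  then obtain n where n: "\<forall>x\<in>Y. dist (\<Sum>i<n. a i * F x ^ i) (\<Sum>i. a i * F x ^ i) < e"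
    using \<open>e > 0\<close> unfolding uniform_limit_iff eventually_sequentially by blast
  have "\<forall>x\<in>Y. norm (g x - (\<Sum>i<n. a i * F x ^ i)) \<le> e"
    using n g by (auto simp: dist_norm norm_minus_commute sums_iff intro: less_imp_le)
  moreover have "(\<lambda>x. \<Sum>i<n. a i * F x ^ i) \<in> polynomial_limits Y"
    by (intro polynomial_limits_sum polynomial_limits_cmult polynomial_limits_power assms)
  ultimately show "\<exists>G\<in>polynomial_limits Y. \<forall>x\<in>Y. norm (g x - G x) \<le> e" by (auto intro!: bexI[rotated])
qed

lemma polynomial_limits_exp:
  assumes "compact Y" "F \<in> polynomial_limits Y"
  shows "(\<lambda>x. exp (F x)) \<in> polynomial_limits Y"
proof -
  obtain B where B: "B > 0" "\<And>x. x \<in> Y \<Longrightarrow> norm (F x) \<le> B"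
    using polynomial_limits_bounded[OF assms] by metis
  show ?thesis
  proof (rule polynomial_limits_power_series[OF assms B(2), where a = "\<lambda>n. 1 / fact n"])
    show "summable (\<lambda>n. norm (1 / fact n :: complex) * B ^ n)"
      using summable_exp[of B] by (simp add: norm_divide field_simps norm_fact)
    show "(\<lambda>n. 1 / fact n * F x ^ n) sums exp (F x)" for x
      using exp_converges[of "F x"] by (simp add: scaleR_conv_of_real field_simps)
  qed
qed

lemma polynomial_limits_Ln_near_1:
  assumes "compact Y" "F \<in> polynomial_limits Y" "\<And>x. x \<in> Y \<Longrightarrow> norm (F x) \<le> 1/2"
  shows "(\<lambda>x. Ln (1 + F x)) \<in> polynomial_limits Y"
proof (rule polynomial_limits_power_series[OF assms, where a = "\<lambda>n. (-1) ^ Suc n / of_nat n"])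
  show "summable (\<lambda>n. norm ((-1) ^ Suc n / of_nat n :: complex) * (1/2) ^ n)"
  proof (rule summable_comparison_test'[OF summable_geometric[of "1/2::real"], of 1])
    show "norm (norm ((-1) ^ Suc n / of_nat n :: complex) * (1/2) ^ n) \<le> (1/2) ^ n" if "1 \<le> n" for n
      using that by (simp add: norm_divide norm_power field_simps)
  qed auto
  show "(\<lambda>n. (-1) ^ Suc n / of_nat n * F x ^ n) sums Ln (1 + F x)" if "x \<in> Y" for x
    using assms(3)[OF that] by (intro Ln_series) auto
qed

section \<open>Logarithms as limits of polynomials\<close>

text \<open>The arguments of \<open>a\<close> and \<open>b\<close> have the same sign, so their difference is again a principal
  argument.\<close>

lemma Ln_divide_same_side:
  assumes a: "a \<notin> \<real>\<^sub>\<le>\<^sub>0" and b: "b \<notin> \<real>\<^sub>\<le>\<^sub>0" and ab: "Im a * Im b \<ge> 0"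
  shows "Ln (a / b) = Ln a - Ln b"
proof -
  have nz: "a \<noteq> 0" "b \<noteq> 0" using a b by auto
  have bounds: "- pi < Im (Ln z)" "Im (Ln z) < pi"
      "0 \<le> Im z \<longleftrightarrow> 0 \<le> Im (Ln z)" "0 < Im z \<longleftrightarrow> 0 < Im (Ln z)" if "z \<notin> \<real>\<^sub>\<le>\<^sub>0" for z
  proof -
    have "z \<noteq> 0" using that by auto
    then show "- pi < Im (Ln z)" "Im (Ln z) < pi"
        "0 \<le> Im z \<longleftrightarrow> 0 \<le> Im (Ln z)" "0 < Im z \<longleftrightarrow> 0 < Im (Ln z)"
      using mpi_less_Im_Ln[of z] Im_Ln_less_pi[OF that] Im_Ln_pos_le[of z] Im_Ln_pos_lt[of z] by auto
  qed
  have "Ln (exp (Ln a - Ln b)) = Ln a - Ln b"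
    using bounds[OF a] bounds[OF b] ab by (intro Ln_exp) (auto simp: zero_le_mult_iff)
  then show ?thesis using nz by (simp add: exp_diff)
qed

text \<open>The logarithm is continued from \<open>t = 0\<close> to \<open>t = 1\<close>, as in pole pushing.  The
  range of \<open>t U\<close> keeps a positive distance from \<open>1\<close> for all \<open>t\<close> in \<open>[0, 1]\<close>, so
  \<open>[0, 1]\<close> can be cut into steps for which the quotient of \<open>1 - t U\<close> by \<open>1 - s U\<close> lies within
  \<open>1/2\<close> of \<open>1\<close>.  The logarithm of this quotient is then given by its power series, and the
  denominator is inverted as an exponential of the logarithm obtained in the step before.\<close>

lemma polynomial_limits_Ln:
  assumes "compact Y" and U: "U \<in> polynomial_limits Y" and "\<kappa> > 0"
    and seg: "\<And>x t. x \<in> Y \<Longrightarrow> 0 \<le> t \<Longrightarrow> t \<le> 1 \<Longrightarrow> \<kappa> \<le> norm (1 - of_real t * U x)"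
  shows "(\<lambda>x. Ln (1 - U x)) \<in> polynomial_limits Y"
proof -
  obtain B where B: "B > 0" "\<And>x. x \<in> Y \<Longrightarrow> norm (U x) \<le> B"
    using polynomial_limits_bounded[OF assms(1,2)] by metis
  obtain N :: nat where N: "real N > 2 * B / \<kappa>" using reals_Archimedean2 by blast
  have "2 * B / \<kappa> > 0" using B \<open>\<kappa> > 0\<close> by simp
  then have "N > 0" using N by (cases "N = 0") auto
  \<comment> \<open>If 1 - t U x = r \<le> 0, then the smaller factor s = t / (1 - r) makes s U x equal to 1.\<close>
  have slit: "1 - of_real t * U x \<notin> \<real>\<^sub>\<le>\<^sub>0" if "x \<in> Y" "0 \<le> t" "t \<le> 1" for x t
  proof
    assume "1 - of_real t * U x \<in> \<real>\<^sub>\<le>\<^sub>0"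
    then obtain r where r: "r \<le> 0" "1 - of_real t * U x = of_real r"
      by (auto elim!: nonpos_Reals_cases)
    define s where "s = t / (1 - r)"
    have s: "0 \<le> s" "s \<le> 1" using r that by (auto simp: s_def field_simps)
    have "of_real t * U x = of_real (1 - r)" using r by (simp add: algebra_simps)
    then have "of_real s * U x = 1" using r by (simp add: s_def field_simps)
    then show False using seg[OF that(1) s] \<open>\<kappa> > 0\<close> by simp
  qed
  have "(\<lambda>x. Ln (1 - of_real (real j / real N) * U x)) \<in> polynomial_limits Y" if "j \<le> N" for j
    using that
  proof (induction j)
    case 0
    then show ?case using polynomial_limits_const[of 0 Y] by simp
  next
    case (Suc j)
    define s where "s = real j / real N"
    define t where "t = real (Suc j) / real N"
    define L where "L = (\<lambda>x. Ln (1 - of_real s * U x))"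
    have L: "L \<in> polynomial_limits Y" using Suc by (simp add: L_def s_def)
    have st: "0 \<le> s" "s \<le> 1" "0 \<le> t" "t \<le> 1" "t - s = 1 / real N"
      using Suc.prems \<open>N > 0\<close> by (auto simp: s_def t_def field_simps)
    define V where "V = (\<lambda>x. - of_real (t - s) * (U x * exp (- 1 * L x)))"
    have V: "V \<in> polynomial_limits Y"
      unfolding V_def using L U
      by (intro polynomial_limits_cmult polynomial_limits_mult polynomial_limits_exp assms(1))
    have expL: "exp (- 1 * L x) = 1 / (1 - of_real s * U x)" if "x \<in> Y" for x
    proof -
      have "1 - of_real s * U x \<noteq> 0" using slit[OF that st(1,2)] by auto
      then show ?thesis by (simp add: L_def exp_minus field_simps)
    qed
    have V_small: "norm (V x) \<le> 1/2" if "x \<in> Y" for x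
    proof -
      have "norm (V x) = (1 / real N) * (norm (U x) / norm (1 - of_real s * U x))"
        using \<open>N > 0\<close> unfolding V_def expL[OF that] st(5) by (simp add: norm_mult norm_divide)
      also have "\<dots> \<le> (1 / real N) * (B / \<kappa>)"
        using B(2)[OF that] seg[OF that st(1,2)] \<open>\<kappa> > 0\<close> B(1) by (intro mult_left_mono frac_le) auto
      also have "\<dots> \<le> 1/2"
        using N \<open>N > 0\<close> \<open>\<kappa> > 0\<close> by (simp add: field_simps)
      finally show ?thesis .
    qed
    have "(\<lambda>x. L x + Ln (1 + V x)) \<in> polynomial_limits Y"
      using L V V_small by (intro polynomial_limits_add polynomial_limits_Ln_near_1 assms(1))
    then have "(\<lambda>x. Ln (1 - of_real t * U x)) \<in> polynomial_limits Y"
    proof (rule polynomial_limits_cong)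
      fix x assume x: "x \<in> Y"
      have nz: "1 - of_real s * U x \<noteq> 0" using slit[OF x st(1,2)] by auto
      have "1 + V x = (1 - of_real t * U x) / (1 - of_real s * U x)"
        unfolding V_def expL[OF x] using nz by (simp add: field_simps)
      moreover have "Im (1 - of_real t * U x) * Im (1 - of_real s * U x) \<ge> 0"
      proof -
        have "Im (1 - of_real t * U x) * Im (1 - of_real s * U x) = t * s * (Im (U x))\<^sup>2"
          by (simp add: power2_eq_square)
        also have "\<dots> \<ge> 0" using st by simp
        finally show ?thesis .
      qed
      ultimately show "L x + Ln (1 + V x) = Ln (1 - of_real t * U x)"
        using Ln_divide_same_side[OF slit[OF x st(3,4)] slit[OF x st(1,2)]] by (simp add: L_def)
    qed
    then show ?case by (simp add: t_def)
  qed
  from this[of N] show ?thesis using \<open>N > 0\<close> by simp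
qed

lemma polynomial_limits_resolvent:
  assumes "compact Y" "U \<in> polynomial_limits Y" "\<kappa> > 0"
    and "\<And>x t. x \<in> Y \<Longrightarrow> 0 \<le> t \<Longrightarrow> t \<le> 1 \<Longrightarrow> \<kappa> \<le> norm (1 - of_real t * U x)"
  shows "(\<lambda>x. 1 / (1 - U x)) \<in> polynomial_limits Y"
proof (rule polynomial_limits_cong)
  show "(\<lambda>x. exp (- 1 * Ln (1 - U x))) \<in> polynomial_limits Y"
    by (intro polynomial_limits_exp polynomial_limits_cmult polynomial_limits_Ln[OF assms] assms(1))
  show "exp (- 1 * Ln (1 - U x)) = 1 / (1 - U x)" if "x \<in> Y" for x
    using assms(4)[OF that, of 1] assms(3) by (cases "U x = 1") (auto simp: exp_minus field_simps)
qed

section \<open>A transition function\<close>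

lemma norm_one_minus_polar_ge:
  assumes "0 < \<alpha>" "\<alpha> \<le> pi/2" "\<alpha> \<le> \<tau>" "\<tau> \<le> 2 * pi - \<alpha>" "\<rho> \<ge> 0"
  shows "sin \<alpha> \<le> norm (1 - of_real \<rho> * cis \<tau>)" and "\<rho> * sin \<alpha> \<le> norm (1 - of_real \<rho> * cis \<tau>)"
proof -
  have "cos \<tau> \<le> cos \<alpha>"
  proof (cases "\<tau> \<le> pi")
    case True
    then show ?thesis using assms by (intro cos_monotone_0_pi_le) auto
  next
    case False
    have "cos \<tau> = cos (2 * pi - \<tau>)" by (simp add: cos_diff)
    also have "\<dots> \<le> cos \<alpha>" using False assms by (intro cos_monotone_0_pi_le) auto
    finally show ?thesis .
  qed
  then have le: "\<rho> * cos \<tau> \<le> \<rho> * cos \<alpha>" using assms by (simp add: mult_left_mono)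
  have sin: "sin \<alpha> \<ge> 0" using assms by (intro sin_ge_zero) auto
  have one: "(\<rho> * sin \<tau>)\<^sup>2 = \<rho>\<^sup>2 - (\<rho> * cos \<tau>)\<^sup>2" for \<tau>
    by (simp add: power_mult_distrib sin_squared_eq algebra_simps)
  have "(norm (1 - of_real \<rho> * cis \<tau>))\<^sup>2 = (1 - \<rho> * cos \<tau>)\<^sup>2 + (\<rho> * sin \<tau>)\<^sup>2"
    by (simp add: cmod_power2)
  then have sq: "(norm (1 - of_real \<rho> * cis \<tau>))\<^sup>2 = 1 - 2 * (\<rho> * cos \<tau>) + \<rho>\<^sup>2"
    unfolding one by (simp add: power2_eq_square algebra_simps)
  have "0 \<le> (1 - \<rho> * cos \<alpha>)\<^sup>2" by simp
  then have "(\<rho> * sin \<alpha>)\<^sup>2 \<le> (norm (1 - of_real \<rho> * cis \<tau>))\<^sup>2"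
    using le unfolding sq one by (simp add: power2_eq_square algebra_simps)
  then show "\<rho> * sin \<alpha> \<le> norm (1 - of_real \<rho> * cis \<tau>)"
    by (rule power2_le_imp_le) simp
  have "0 \<le> (\<rho> - cos \<alpha>)\<^sup>2" by simp
  then have "(sin \<alpha>)\<^sup>2 \<le> (norm (1 - of_real \<rho> * cis \<tau>))\<^sup>2"
    using le unfolding sq sin_squared_eq by (simp add: power2_eq_square algebra_simps)
  then show "sin \<alpha> \<le> norm (1 - of_real \<rho> * cis \<tau>)"
    by (rule power2_le_imp_le) simp
qed

lemma Ln_polar: "\<rho> > 0 \<Longrightarrow> - pi < \<sigma> \<Longrightarrow> \<sigma> \<le> pi \<Longrightarrow> Ln (of_real \<rho> * cis \<sigma>) = of_real (ln \<rho>) + \<i> * of_real \<sigma>"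
proof -
  assume a: "\<rho> > 0" "- pi < \<sigma>" "\<sigma> \<le> pi"
  have "of_real \<rho> * cis \<sigma> = exp (of_real (ln \<rho>) + \<i> * of_real \<sigma>)"
    using a by (simp add: exp_add cis_conv_exp exp_of_real)
  then show ?thesis using a by simp
qed

lemma polar_slit:
  assumes "\<rho> > 0" "- pi < \<sigma>" "\<sigma> < pi"
  shows "of_real \<rho> * cis \<sigma> \<notin> \<real>\<^sub>\<le>\<^sub>0" "1 + of_real \<rho> * cis \<sigma> \<notin> \<real>\<^sub>\<le>\<^sub>0"
proof -
  have "\<not> (sin \<sigma> = 0 \<and> cos \<sigma> < 0)"
  proof
    assume "sin \<sigma> = 0 \<and> cos \<sigma> < 0"
    moreover have "\<sigma> = 0" if "sin \<sigma> = 0" using sin_eq_0_pi[of \<sigma>] that assms by simp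
    ultimately show False by auto
  qed
  moreover have "cos \<sigma> \<noteq> 0" if "sin \<sigma> = 0"
    using that sin_zero_abs_cos_one by force
  ultimately have *: "sin \<sigma> \<noteq> 0 \<or> cos \<sigma> > 0" by fastforce
  then show "of_real \<rho> * cis \<sigma> \<notin> \<real>\<^sub>\<le>\<^sub>0"
    using assms by (auto simp: complex_nonpos_Reals_iff mult_le_0_iff)
  show "1 + of_real \<rho> * cis \<sigma> \<notin> \<real>\<^sub>\<le>\<^sub>0"
  proof
    assume "1 + of_real \<rho> * cis \<sigma> \<in> \<real>\<^sub>\<le>\<^sub>0"
    then have "1 + \<rho> * cos \<sigma> \<le> 0" "\<rho> * sin \<sigma> = 0" by (auto simp: complex_nonpos_Reals_iff)
    then have "cos \<sigma> > 0" using * assms by simp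
    then have "\<rho> * cos \<sigma> > 0" using assms(1) by (rule mult_pos_pos[rotated])
    then show False using \<open>1 + \<rho> * cos \<sigma> \<le> 0\<close> by linarith
  qed
qed

text \<open>With \<open>y = - \<rho> e\<^sup>i\<^sup>\<tau>\<close>, the function is \<open>Ln (1 + y) = Ln y + Ln (1 + 1 / y)\<close>; the first summand is
  the stated main term and the second is of order \<open>1 / \<rho>\<close>.\<close>

lemma Ln_one_minus_polar_far:
  assumes "0 < \<tau>" "\<tau> < 2 * pi" "\<rho> > 2"
  shows "norm (Ln (1 - of_real \<rho> * cis \<tau>) - (of_real (ln \<rho>) + \<i> * of_real (\<tau> - pi))) \<le> 2 / \<rho>"
proof -
  define y where "y = of_real \<rho> * cis (\<tau> - pi)"
  have y: "y = - (of_real \<rho> * cis \<tau>)" by (simp add: y_def cis_divide[symmetric])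
  have slit: "y \<notin> \<real>\<^sub>\<le>\<^sub>0" "1 + y \<notin> \<real>\<^sub>\<le>\<^sub>0"
    using polar_slit[of \<rho> "\<tau> - pi"] assms by (auto simp: y_def)
  have "Ln ((1 + y) / y) = Ln (1 + y) - Ln y"
    using slit by (intro Ln_divide_same_side) auto
  moreover have "(1 + y) / y = 1 + 1 / y" using slit(1) by (cases "y = 0") (auto simp: add_divide_distrib)
  moreover have "Ln y = of_real (ln \<rho>) + \<i> * of_real (\<tau> - pi)"
    unfolding y_def using assms by (intro Ln_polar) auto
  moreover have ny: "norm (1 / y) = 1 / \<rho>" using assms by (simp add: y norm_divide norm_mult)
  moreover have "norm (Ln (1 + 1 / y)) \<le> 2 * norm (1 / y)"
    by (rule norm_Ln_le) (use assms in \<open>simp add: ny\<close>)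
  ultimately show ?thesis by (simp add: y)
qed

lemma Ln_one_minus_polar_near:
  assumes "0 < \<alpha>" "\<alpha> \<le> pi/2" "\<alpha> \<le> \<tau>" "\<tau> \<le> 2 * pi - \<alpha>" "\<rho> \<ge> 0" "\<rho> \<le> 2"
  shows "norm (Ln (1 - of_real \<rho> * cis \<tau>)) \<le> pi + ln 3 - ln (sin \<alpha>)"
proof -
  let ?u = "1 - of_real \<rho> * cis \<tau>"
  have sin: "0 < sin \<alpha>" "sin \<alpha> \<le> 1" using assms by (auto intro!: sin_gt_zero)
  have lo: "sin \<alpha> \<le> norm ?u" using norm_one_minus_polar_ge(1) assms by blast
  have hi: "norm ?u \<le> 3"
    using norm_triangle_ineq4[of 1 "of_real \<rho> * cis \<tau>"] assms by (simp add: norm_mult)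
  have "?u \<noteq> 0" using lo sin by auto
  have "ln (sin \<alpha>) \<le> ln (norm ?u)" "ln (norm ?u) \<le> ln 3" "ln (sin \<alpha>) \<le> 0" "(0::real) \<le> ln 3"
    using lo hi sin \<open>?u \<noteq> 0\<close> by (auto simp del: norm_le_zero_iff intro!: iffD2[OF ln_le_cancel_iff])
  then have "\<bar>Re (Ln ?u)\<bar> \<le> ln 3 - ln (sin \<alpha>)"
    unfolding Re_Ln[OF \<open>?u \<noteq> 0\<close>] by linarith
  moreover have "\<bar>Im (Ln ?u)\<bar> \<le> pi"
    using mpi_less_Im_Ln[OF \<open>?u \<noteq> 0\<close>] Im_Ln_le_pi[OF \<open>?u \<noteq> 0\<close>] by simp
  ultimately show ?thesis using cmod_le[of "Ln ?u"] by simp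
qed

text \<open>For large \<open>s\<close> the difference of the logarithms is close to the constant
  \<open>\<i> (\<sigma> - \<tau>)\<close>, since the logarithmic growth cancels.  The estimates
  only hold for angles between \<open>\<alpha>\<close> and \<open>2 \<pi> - \<alpha>\<close>, that is, away from the branch cut.\<close>

definition Ln_error :: "real \<Rightarrow> real \<Rightarrow> real \<Rightarrow> complex" where
  "Ln_error s \<sigma> \<tau> = Ln (1 - of_real s * cis \<sigma>) - Ln (1 - of_real s * cis \<tau>) - \<i> * of_real (\<sigma> - \<tau>)"

lemma Ln_error_bounded:
  assumes \<alpha>: "0 < \<alpha>" "\<alpha> \<le> pi/2"
  obtains C where "C > 0"
    "\<And>s \<sigma> \<tau>. \<lbrakk>s \<ge> 0; \<alpha> \<le> \<sigma>; \<sigma> \<le> 2 * pi - \<alpha>; \<alpha> \<le> \<tau>; \<tau> \<le> 2 * pi - \<alpha>\<rbrakk> \<Longrightarrow>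
       norm (Ln_error s \<sigma> \<tau>) \<le> C \<and>
       s * norm (Ln_error s \<sigma> \<tau>) \<le> C"
proof -
  define C0 where "C0 = pi + ln 3 - ln (sin \<alpha>)"
  define C where "C = 4 * C0 + 4 * pi + 4"
  have "sin \<alpha> > 0" using \<alpha> by (intro sin_gt_zero) auto
  then have "ln (sin \<alpha>) \<le> 0" by simp
  moreover have "(0::real) \<le> ln 3" by simp
  ultimately have "C0 > 0" using pi_gt_zero unfolding C0_def by linarith
  then have "C > 0" using pi_gt_zero unfolding C_def by linarith
  moreover have "norm (Ln_error s \<sigma> \<tau>) \<le> C \<and>
       s * norm (Ln_error s \<sigma> \<tau>) \<le> C"
    (is "norm ?E \<le> C \<and> _")
    if s: "s \<ge> 0" and a: "\<alpha> \<le> \<sigma>" "\<sigma> \<le> 2 * pi - \<alpha>" "\<alpha> \<le> \<tau>" "\<tau> \<le> 2 * pi - \<alpha>" for s \<sigma> \<tau>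
  proof (cases "s \<le> 2")
    case True
    have "norm ?E = norm (Ln (1 - of_real s * cis \<sigma>) - Ln (1 - of_real s * cis \<tau>) - \<i> * of_real (\<sigma> - \<tau>))"
      by (simp add: Ln_error_def)
    also have "\<dots> \<le> norm (Ln (1 - of_real s * cis \<sigma>)) + norm (Ln (1 - of_real s * cis \<tau>))
        + norm (\<i> * of_real (\<sigma> - \<tau>))"
      by (intro order_trans[OF norm_triangle_ineq4] add_right_mono norm_triangle_ineq4)
    also have "\<dots> \<le> C0 + C0 + 2 * pi"
      using Ln_one_minus_polar_near[OF \<alpha> a(1,2) s True] Ln_one_minus_polar_near[OF \<alpha> a(3,4) s True] a \<alpha>
      by (intro add_mono) (auto simp: C0_def norm_mult simp del: of_real_diff)
    finally have E: "norm ?E \<le> 2 * C0 + 2 * pi" by simp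
    then have "s * norm ?E \<le> 2 * (2 * C0 + 2 * pi)"
      using s True \<open>C0 > 0\<close> by (intro mult_mono) auto
    moreover have "2 * C0 + 2 * pi \<le> C" "2 * (2 * C0 + 2 * pi) \<le> C"
      using \<open>C0 > 0\<close> by (auto simp: C_def)
    ultimately show ?thesis using E by linarith
  next
    case False
    let ?f = "\<lambda>\<tau>. Ln (1 - of_real s * cis \<tau>) - (of_real (ln s) + \<i> * of_real (\<tau> - pi))"
    have "?E = ?f \<sigma> - ?f \<tau>" by (simp add: Ln_error_def algebra_simps)
    then have "norm ?E \<le> norm (?f \<sigma>) + norm (?f \<tau>)" by (metis norm_triangle_ineq4)
    also have "\<dots> \<le> 2 / s + 2 / s"
      using False a \<alpha> by (intro add_mono Ln_one_minus_polar_far) auto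
    finally have E: "norm ?E \<le> 4 / s" by simp
    also have "4 / s \<le> 4" using False by (simp add: field_simps)
    finally have "norm ?E \<le> 4" .
    moreover have "s * norm ?E \<le> s * (4 / s)" using E s by (rule mult_left_mono)
    moreover have "s * (4 / s) = 4" using False by simp
    moreover have "4 \<le> C" using \<open>C0 > 0\<close> by (simp add: C_def)
    ultimately show ?thesis by linarith
  qed
  ultimately show ?thesis using that by blast
qed

text \<open>The branch cuts are the half lines of argument \<open>\<plusminus>\<alpha>\<close> that start at distance \<open>\<eta>\<close> from the
  origin.  The normalisation is chosen so that the limit at infinity is \<open>0\<close> to the left of the cuts;
  crossing one of them changes the numerator by the period \<open>2 \<pi> \<i>\<close>, so that the limit is \<open>1\<close>
  between them.\<close>

definition transition :: "real \<Rightarrow> real \<Rightarrow> complex \<Rightarrow> complex" where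
  "transition \<alpha> \<eta> v =
     (Ln (1 - v / (of_real \<eta> * cis \<alpha>)) - Ln (1 - v / (of_real \<eta> * cis (- \<alpha>))) + 2 * \<i> * of_real \<alpha>)
       / (2 * of_real pi * \<i>)"

definition wide_sector :: "real \<Rightarrow> complex set" where
  "wide_sector \<beta> = {of_real \<rho> * cis \<theta> | \<rho> \<theta>. \<rho> \<ge> 0 \<and> \<beta> \<le> \<theta> \<and> \<theta> \<le> 2 * pi - \<beta>}"

text \<open>All bounds are uniform in \<open>\<eta>\<close>, because \<open>\<eta>\<close> enters only through the ratio of \<open>v\<close> and \<open>\<eta>\<close>.  Each
  bound appears twice: once without a factor, which is used near the origin, and once with the
  factor \<open>norm v\<close>, which expresses decay.\<close>

lemma transition_asymptotics:
  assumes \<alpha>: "0 < \<alpha>" "\<alpha> \<le> pi/2"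
  obtains C where "C > 0"
    "\<And>\<eta> \<rho>. \<lbrakk>\<eta> > 0; \<rho> \<ge> 0\<rbrakk> \<Longrightarrow> norm (transition \<alpha> \<eta> (of_real \<rho>) - 1) \<le> C"
    "\<And>\<eta> \<rho>. \<lbrakk>\<eta> > 0; \<rho> \<ge> 0\<rbrakk> \<Longrightarrow> \<rho> * norm (transition \<alpha> \<eta> (of_real \<rho>) - 1) \<le> C * \<eta>"
    "\<And>\<eta> v. \<lbrakk>\<eta> > 0; v \<in> wide_sector (2 * \<alpha>)\<rbrakk> \<Longrightarrow> norm (transition \<alpha> \<eta> v) \<le> C"
    "\<And>\<eta> v. \<lbrakk>\<eta> > 0; v \<in> wide_sector (2 * \<alpha>)\<rbrakk> \<Longrightarrow> norm v * norm (transition \<alpha> \<eta> v) \<le> C * \<eta>"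
proof -
  obtain C where C: "C > 0"
    "\<And>s \<sigma> \<tau>. \<lbrakk>s \<ge> 0; \<alpha> \<le> \<sigma>; \<sigma> \<le> 2 * pi - \<alpha>; \<alpha> \<le> \<tau>; \<tau> \<le> 2 * pi - \<alpha>\<rbrakk> \<Longrightarrow>
       norm (Ln_error s \<sigma> \<tau>) \<le> C \<and> s * norm (Ln_error s \<sigma> \<tau>) \<le> C"
    using Ln_error_bounded[OF \<alpha>] by metis
  \<comment> \<open>The angles \<sigma> and \<tau> of v relative to the two branch points are only given modulo 2 \<pi>; the
    error is controlled for the representatives between \<alpha> and 2 \<pi> - \<alpha>.\<close>
  have T: "transition \<alpha> \<eta> (of_real \<rho> * cis \<theta>)
      = Ln_error (\<rho>/\<eta>) \<sigma> \<tau> / (2 * of_real pi * \<i>) + of_real (\<sigma> - \<tau> + 2 * \<alpha>) / (2 * of_real pi)"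
    if "\<eta> > 0" "cis \<sigma> = cis (\<theta> - \<alpha>)" "cis \<tau> = cis (\<theta> + \<alpha>)" for \<eta> \<rho> \<theta> \<sigma> \<tau>
  proof -
    have 1: "of_real \<rho> * cis \<theta> / (of_real \<eta> * cis \<alpha>) = of_real (\<rho>/\<eta>) * cis \<sigma>"
      using that(1) unfolding that(2) cis_divide[symmetric] by simp
    have 2: "of_real \<rho> * cis \<theta> / (of_real \<eta> * cis (- \<alpha>)) = of_real (\<rho>/\<eta>) * cis \<tau>"
    proof -
      have "cis \<tau> = cis \<theta> / cis (- \<alpha>)" using that(3) by (simp add: cis_divide)
      then show ?thesis using that(1) by simp
    qed
    show ?thesis
      unfolding transition_def 1 2 Ln_error_def
      by (simp add: add_divide_distrib diff_divide_distrib ring_distribs)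
  qed
  have div: "norm (x / (2 * of_real pi * \<i>)) \<le> norm x" for x :: complex
  proof -
    have "norm x * 1 \<le> norm x * (2 * pi)" using pi_gt3 by (intro mult_left_mono) auto
    then show ?thesis by (simp add: norm_divide norm_mult field_simps)
  qed
  have scale: "\<rho> * norm e \<le> C * \<eta>" if "(\<rho> / \<eta>) * norm e \<le> C" "\<eta> > 0" for \<rho> \<eta> and e :: complex
    using that by (simp add: field_simps)
  have main: "norm (e / (2 * of_real pi * \<i>)) \<le> C \<and> \<rho> * norm (e / (2 * of_real pi * \<i>)) \<le> C * \<eta>"
    if "norm e \<le> C \<and> (\<rho> / \<eta>) * norm e \<le> C" "\<eta> > 0" "\<rho> \<ge> 0" for \<rho> \<eta> and e :: complex
  proof -
    have "\<rho> * norm (e / (2 * of_real pi * \<i>)) \<le> \<rho> * norm e"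
      using div \<open>\<rho> \<ge> 0\<close> by (rule mult_left_mono)
    moreover have "\<rho> * norm e \<le> C * \<eta>" using that by (intro scale) auto
    ultimately show ?thesis using div[of e] that(1) by linarith
  qed
  \<comment> \<open>On the ray the angle - \<alpha> has to be written as 2 \<pi> - \<alpha>; the extra 2 \<pi> is the jump.\<close>
  have ray: "norm (transition \<alpha> \<eta> (of_real \<rho>) - 1) \<le> C \<and>
      \<rho> * norm (transition \<alpha> \<eta> (of_real \<rho>) - 1) \<le> C * \<eta>" if "\<eta> > 0" "\<rho> \<ge> 0" for \<eta> \<rho>
  proof -
    have "transition \<alpha> \<eta> (of_real \<rho>) - 1 = Ln_error (\<rho>/\<eta>) (2 * pi - \<alpha>) \<alpha> / (2 * of_real pi * \<i>)"
    proof -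
      have "cis (2 * pi - \<alpha>) = cis (0 - \<alpha>)" "cis \<alpha> = cis (0 + \<alpha>)"
        by (simp_all add: complex_eq_iff cos_diff sin_diff)
      note T[OF that(1) this, of \<rho>]
      moreover have "(2 * pi - \<alpha> - \<alpha> + 2 * \<alpha>) = 2 * pi" by simp
      ultimately show ?thesis by simp
    qed
    then show ?thesis
      using main[where e = "Ln_error (\<rho>/\<eta>) (2 * pi - \<alpha>) \<alpha>" and \<rho> = \<rho> and \<eta> = \<eta>] C(2)[of "\<rho>/\<eta>" "2 * pi - \<alpha>" \<alpha>] that \<alpha>
      by simp
  qed
  have sec: "norm (transition \<alpha> \<eta> v) \<le> C \<and> norm v * norm (transition \<alpha> \<eta> v) \<le> C * \<eta>"
    if "\<eta> > 0" "v \<in> wide_sector (2 * \<alpha>)" for \<eta> v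
  proof -
    obtain \<rho> \<theta> where v: "v = of_real \<rho> * cis \<theta>" "\<rho> \<ge> 0" "2 * \<alpha> \<le> \<theta>" "\<theta> \<le> 2 * pi - 2 * \<alpha>"
      using \<open>v \<in> wide_sector (2 * \<alpha>)\<close> unfolding wide_sector_def by blast
    have "transition \<alpha> \<eta> v = Ln_error (\<rho>/\<eta>) (\<theta> - \<alpha>) (\<theta> + \<alpha>) / (2 * of_real pi * \<i>)"
      using T[OF that(1), of "\<theta> - \<alpha>" \<theta> "\<theta> + \<alpha>" \<rho>] by (simp add: v)
    then show ?thesis
      using main[where e = "Ln_error (\<rho>/\<eta>) (\<theta> - \<alpha>) (\<theta> + \<alpha>)" and \<rho> = \<rho> and \<eta> = \<eta>]
        C(2)[of "\<rho>/\<eta>" "\<theta> - \<alpha>" "\<theta> + \<alpha>"] v that \<alpha> by (simp add: norm_mult)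
  qed
  show ?thesis using that[OF C(1)] ray sec by blast
qed

lemma wide_sector_scale:
  assumes "v \<in> wide_sector \<beta>" "r \<ge> 0"
  shows "of_real r * v \<in> wide_sector \<beta>"
proof -
  obtain \<rho> \<theta> where "v = of_real \<rho> * cis \<theta>" "\<rho> \<ge> 0" "\<beta> \<le> \<theta>" "\<theta> \<le> 2 * pi - \<beta>"
    using assms(1) unfolding wide_sector_def by blast
  then have "of_real r * v = of_real (r * \<rho>) * cis \<theta>" "r * \<rho> \<ge> 0" "\<beta> \<le> \<theta>" "\<theta> \<le> 2 * pi - \<beta>"
    using assms(2) by simp_all
  then show ?thesis unfolding wide_sector_def by blast
qed

lemma norm_one_minus_wide_sector_ge:
  assumes "0 < \<alpha>" "\<alpha> \<le> pi/2" "u \<in> wide_sector \<alpha>"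
  shows "sin \<alpha> \<le> norm (1 - u)" and "norm u * sin \<alpha> \<le> norm (1 - u)"
  using norm_one_minus_polar_ge[OF assms(1,2)] assms(3) by (auto simp: wide_sector_def norm_mult)

lemma norm_resolvent_wide_sector_le:
  assumes "0 < \<alpha>" "\<alpha> \<le> pi/2" "u \<in> wide_sector \<alpha>"
  shows "norm (1 / (1 - u)) \<le> 1 / sin \<alpha>"
proof -
  have "sin \<alpha> > 0" using assms by (intro sin_gt_zero) auto
  then show ?thesis
    using norm_one_minus_wide_sector_ge(1)[OF assms] unfolding norm_divide norm_one
    by (intro frac_le) auto
qed

lemma polynomial_limits_wide_sector:
  assumes "0 < \<alpha>" "\<alpha> \<le> pi/2" "compact Y" "U \<in> polynomial_limits Y"
    and U: "\<And>x. x \<in> Y \<Longrightarrow> U x \<in> wide_sector \<alpha>"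
  shows "(\<lambda>x. Ln (1 - U x)) \<in> polynomial_limits Y"
    and "(\<lambda>x. 1 / (1 - U x)) \<in> polynomial_limits Y"
proof -
  have "sin \<alpha> > 0" using assms by (intro sin_gt_zero) auto
  moreover have "sin \<alpha> \<le> norm (1 - of_real t * U x)" if "x \<in> Y" "0 \<le> t" "t \<le> 1" for x t
    using norm_one_minus_wide_sector_ge(1)[OF assms(1,2) wide_sector_scale[OF U]] that by blast
  ultimately show "(\<lambda>x. Ln (1 - U x)) \<in> polynomial_limits Y"
    "(\<lambda>x. 1 / (1 - U x)) \<in> polynomial_limits Y"
    using polynomial_limits_Ln[OF assms(3,4)] polynomial_limits_resolvent[OF assms(3,4)] by blast+
qed

text \<open>Seen from either of the two branch points, both the ray and the sector avoid the branch cut by the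
  angle \<open>\<alpha>\<close>.\<close>

lemma wide_sector_rotate:
  assumes \<alpha>: "0 < \<alpha>" "\<alpha> \<le> pi/2" and "\<eta> > 0"
    and v: "v \<in> of_real ` {0..} \<union> wide_sector (2 * \<alpha>)"
  shows "v / (of_real \<eta> * cis \<alpha>) \<in> wide_sector \<alpha>" and "v / (of_real \<eta> * cis (- \<alpha>)) \<in> wide_sector \<alpha>"
proof -
  have rot: "of_real \<rho> * cis \<theta> / (of_real \<eta> * cis \<beta>) \<in> wide_sector \<alpha>"
    if "\<rho> \<ge> 0" "\<alpha> \<le> \<sigma>" "\<sigma> \<le> 2 * pi - \<alpha>" "cis \<sigma> = cis (\<theta> - \<beta>)" for \<rho> \<theta> \<beta> \<sigma>
  proof -
    have "of_real \<rho> * cis \<theta> / (of_real \<eta> * cis \<beta>) = of_real (\<rho> / \<eta>) * cis \<sigma>"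
      using \<open>\<eta> > 0\<close> unfolding that(4) cis_divide[symmetric] by simp
    moreover have "\<rho> / \<eta> \<ge> 0" using that \<open>\<eta> > 0\<close> by simp
    ultimately show ?thesis
      unfolding wide_sector_def using that by blast
  qed
  have period: "cis (2 * pi - \<alpha>) = cis (0 - \<alpha>)"
    by (simp add: complex_eq_iff cos_diff sin_diff)
  from v have "v / (of_real \<eta> * cis \<alpha>) \<in> wide_sector \<alpha> \<and> v / (of_real \<eta> * cis (- \<alpha>)) \<in> wide_sector \<alpha>"
  proof
    assume "v \<in> of_real ` {0..}"
    then obtain \<rho> where "v = of_real \<rho> * cis 0" "\<rho> \<ge> 0" by auto
    then show ?thesis
      using rot[of \<rho> "2 * pi - \<alpha>" 0 \<alpha>] rot[of \<rho> \<alpha> 0 "- \<alpha>"] period \<alpha> by simp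
  next
    assume "v \<in> wide_sector (2 * \<alpha>)"
    then obtain \<rho> \<theta> where v: "v = of_real \<rho> * cis \<theta>" "\<rho> \<ge> 0" "2 * \<alpha> \<le> \<theta>" "\<theta> \<le> 2 * pi - 2 * \<alpha>"
      unfolding wide_sector_def by blast
    then show ?thesis
      using rot[of \<rho> "\<theta> - \<alpha>" \<theta> \<alpha>] rot[of \<rho> "\<theta> + \<alpha>" \<theta> "- \<alpha>"] \<alpha> by simp
  qed
  then show "v / (of_real \<eta> * cis \<alpha>) \<in> wide_sector \<alpha>" "v / (of_real \<eta> * cis (- \<alpha>)) \<in> wide_sector \<alpha>"
    by auto
qed

lemma polynomial_limits_transition:
  assumes \<alpha>: "0 < \<alpha>" "\<alpha> \<le> pi/2" and "\<eta> > 0" and "compact Y" "Q \<in> polynomial_limits Y"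
    and Q: "\<And>x. x \<in> Y \<Longrightarrow> Q x \<in> of_real ` {0..} \<union> wide_sector (2 * \<alpha>)"
  shows "(\<lambda>x. transition \<alpha> \<eta> (Q x)) \<in> polynomial_limits Y"
proof -
  have "(\<lambda>x. Ln (1 - Q x / (of_real \<eta> * cis \<beta>))) \<in> polynomial_limits Y"
    if "\<beta> = \<alpha> \<or> \<beta> = - \<alpha>" for \<beta>
  proof (intro polynomial_limits_wide_sector(1)[OF \<alpha> \<open>compact Y\<close>])
    show "(\<lambda>x. Q x / (of_real \<eta> * cis \<beta>)) \<in> polynomial_limits Y"
      using polynomial_limits_cmult[OF assms(5,4), of "1 / (of_real \<eta> * cis \<beta>)"] by simp
    show "Q x / (of_real \<eta> * cis \<beta>) \<in> wide_sector \<alpha>" if "x \<in> Y" for x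
      using wide_sector_rotate[OF \<alpha> \<open>\<eta> > 0\<close> Q[OF that]] \<open>\<beta> = \<alpha> \<or> \<beta> = - \<alpha>\<close> by auto
  qed
  from this[of \<alpha>] this[of "- \<alpha>"]
  have "(\<lambda>x. (1 / (2 * of_real pi * \<i>)) * (Ln (1 - Q x / (of_real \<eta> * cis \<alpha>))
      - Ln (1 - Q x / (of_real \<eta> * cis (- \<alpha>))) + 2 * \<i> * of_real \<alpha>)) \<in> polynomial_limits Y"
    by (intro polynomial_limits_cmult polynomial_limits_add polynomial_limits_diff
        polynomial_limits_const assms(4)) auto
  then show ?thesis
    by (rule polynomial_limits_cong) (simp add: transition_def)
qed

section \<open>Kallin's lemma\<close>

lemma polynomial_hull_limit_bound:
  assumes "z \<in> polynomial_hull X" "F \<in> polynomial_limits (insert z X)"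
    and "\<And>x. x \<in> X \<Longrightarrow> norm (F x) \<le> B"
  shows "norm (F z) \<le> B"
proof (rule field_le_epsilon)
  fix e :: real assume "e > 0"
  then obtain p where p: "\<And>x. x \<in> insert z X \<Longrightarrow> norm (F x - poly_eval2 p x) \<le> e / 2"
    using polynomial_limitsE[OF assms(2), of "e / 2"] by auto
  have "norm (poly_eval2 p x) \<le> B + e / 2" if "x \<in> X" for x
    using p[of x] assms(3)[OF that] that norm_triangle_ineq4[of "F x" "F x - poly_eval2 p x"] by simp
  then have "norm (poly_eval2 p z) \<le> B + e / 2"
    using assms(1) unfolding polynomial_hull_def by blast
  then show "norm (F z) \<le> B + e"
    using p[of z] norm_triangle_ineq[of "F z - poly_eval2 p z" "poly_eval2 p z"] by simp
qed

text \<open>The idea is to test \<open>z\<close> on \<open>F f\<^sup>k\<close>.  The bound \<open>A\<close> is fixed before \<open>k\<close>, and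
  \<open>\<epsilon>\<close> is chosen after it.\<close>

lemma polynomial_hull_localize:
  assumes "compact X" and z: "z \<in> polynomial_hull X" and X: "X = Y1 \<union> Y2" and "Y1 \<noteq> {}" and "A > 0"
    and F: "\<And>\<epsilon>. \<epsilon> > 0 \<Longrightarrow> \<exists>F\<in>polynomial_limits (insert z X).
      (\<forall>x\<in>Y1. norm (F x) \<le> A) \<and> (\<forall>x\<in>Y2. norm (F x) \<le> \<epsilon>) \<and> 1/2 \<le> norm (F z)"
  shows "z \<in> polynomial_hull Y1"
  unfolding polynomial_hull_def
proof (intro CollectI allI impI)
  fix f d assume d: "\<forall>w\<in>Y1. norm (poly_eval2 f w) \<le> d"
  define a where "a = norm (poly_eval2 f z)"
  show "norm (poly_eval2 f z) \<le> d"
  proof (rule ccontr)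
    assume "\<not> norm (poly_eval2 f z) \<le> d"
    then have "d < a" by (simp add: a_def)
    obtain y where "y \<in> Y1" using \<open>Y1 \<noteq> {}\<close> by blast
    then have "d \<ge> 0" using d norm_ge_zero order_trans by blast
    then have "a > 0" using \<open>d < a\<close> by simp
    obtain M where M: "M > 0" "\<And>x. x \<in> X \<Longrightarrow> norm (poly_eval2 f x) \<le> M"
      using poly_eval2_bounded_on_compact[OF \<open>compact X\<close>] by metis
    have "1 / (4 * A) > 0" "d / a < 1" using \<open>A > 0\<close> \<open>d < a\<close> \<open>a > 0\<close> by simp_all
    then obtain k where "(d / a) ^ k < 1 / (4 * A)" using real_arch_pow_inv by blast
    then have k: "A * d ^ k \<le> a ^ k / 4"
      using \<open>A > 0\<close> \<open>a > 0\<close> by (simp add: field_simps)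
    define \<epsilon> where "\<epsilon> = a ^ k / (4 * M ^ k)"
    have "\<epsilon> > 0" using \<open>a > 0\<close> M by (simp add: \<epsilon>_def)
    then obtain F where F: "F \<in> polynomial_limits (insert z X)" "\<forall>x\<in>Y1. norm (F x) \<le> A"
        "\<forall>x\<in>Y2. norm (F x) \<le> \<epsilon>" "1/2 \<le> norm (F z)"
      using F by meson
    define G where "G = (\<lambda>x. F x * poly_eval2 f x ^ k)"
    have "G \<in> polynomial_limits (insert z X)"
      unfolding G_def using F(1) \<open>compact X\<close>
      by (intro polynomial_limits_mult polynomial_limits_power polynomial_limits_poly) auto
    moreover have "norm (G x) \<le> a ^ k / 4" if "x \<in> X" for x
    proof (cases "x \<in> Y1")
      case True
      have "norm (G x) \<le> A * d ^ k"
        using F(2) d True \<open>A > 0\<close> unfolding G_def norm_mult norm_power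
        by (intro mult_mono power_mono) auto
      then show ?thesis using k by simp
    next
      case False
      then have "norm (G x) \<le> \<epsilon> * M ^ k"
        using F(3) M that X \<open>\<epsilon> > 0\<close> unfolding G_def norm_mult norm_power
        by (intro mult_mono power_mono) auto
      then show ?thesis using M by (simp add: \<epsilon>_def)
    qed
    ultimately have "norm (G z) \<le> a ^ k / 4"
      using polynomial_hull_limit_bound[OF z] by blast
    moreover have "1/2 * a ^ k \<le> norm (G z)"
      using F(4) \<open>a > 0\<close> unfolding G_def norm_mult norm_power a_def by (intro mult_right_mono) auto
    moreover have "a ^ k > 0" using \<open>a > 0\<close> by simp
    ultimately show False by linarith
  qed
qed

text \<open>The peaking function \<open>1 / (1 - q / c)\<close> is small only away from the zeros of \<open>q\<close>, so \<open>X2\<close> as a whole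
  cannot be discarded.  But a polynomial \<open>f\<close> that is bounded by \<open>d\<close> on \<open>X1\<close> is at most slightly larger
  than \<open>d\<close> on a neighbourhood of the zeros of \<open>q\<close> in \<open>X2\<close>, and by compactness \<open>q\<close> is bounded away
  from zero on the rest of \<open>X2\<close>.\<close>

lemma polynomial_hull_localize_zero:
  assumes "compact X" and z: "z \<in> polynomial_hull X" and X: "X = X1 \<union> X2" "X1 \<noteq> {}"
    and \<alpha>: "0 < \<alpha>" "\<alpha> \<le> pi/2"
    and QY: "\<And>x. x \<in> insert z X \<Longrightarrow> poly_eval2 q x \<in> of_real ` {0..} \<union> wide_sector (2 * \<alpha>)"
    and "poly_eval2 q z = 0" and zero: "\<And>x. x \<in> X2 \<Longrightarrow> poly_eval2 q x = 0 \<Longrightarrow> x \<in> X1"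
  shows "z \<in> polynomial_hull X1"
  unfolding polynomial_hull_def
proof (intro CollectI allI impI)
  define Q where "Q = poly_eval2 q"
  note QY = QY[folded Q_def]
  have Q_lim: "Q \<in> polynomial_limits (insert z X)" by (simp add: Q_def polynomial_limits_poly)
  have sin: "sin \<alpha> > 0" using \<alpha> by (intro sin_gt_zero) auto
  fix f d assume d: "\<forall>w\<in>X1. norm (poly_eval2 f w) \<le> d"
  show "norm (poly_eval2 f z) \<le> d"
  proof (rule field_le_epsilon)
    fix e :: real assume "e > 0"
    define Y1 where "Y1 = {x \<in> X. norm (poly_eval2 f x) \<le> d + e}"
    define Y2 where "Y2 = {x \<in> X. d + e \<le> norm (poly_eval2 f x)}"
    have XY: "X = Y1 \<union> Y2" by (auto simp: Y1_def Y2_def)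
    have "X1 \<subseteq> Y1" using d \<open>e > 0\<close> by (fastforce simp: Y1_def X(1))
    then have "Y1 \<noteq> {}" using \<open>X1 \<noteq> {}\<close> by blast
    have "compact Y2"
    proof -
      have "closed {x. d + e \<le> norm (poly_eval2 f x)}"
        by (intro closed_Collect_le continuous_intros continuous_on_poly_eval2)
      then have "compact (X \<inter> {x. d + e \<le> norm (poly_eval2 f x)})"
        using \<open>compact X\<close> by (rule compact_Int_closed[rotated])
      moreover have "Y2 = X \<inter> {x. d + e \<le> norm (poly_eval2 f x)}" by (auto simp: Y2_def)
      ultimately show ?thesis by simp
    qed
    have Y2_nz: "Q x \<noteq> 0" if "x \<in> Y2" for x
    proof
      assume "Q x = 0"
      then have "x \<in> X1" using zero[of x] that by (auto simp: Y2_def X(1) Q_def)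
      then have "norm (poly_eval2 f x) \<le> d" using d by blast
      then show False using that \<open>e > 0\<close> by (simp add: Y2_def)
    qed
    obtain m where m: "m > 0" "\<And>x. x \<in> Y2 \<Longrightarrow> m \<le> norm (Q x)"
    proof (cases "Y2 = {}")
      case True
      then show ?thesis using that[of 1] by auto
    next
      case False
      have "continuous_on Y2 (\<lambda>x. norm (Q x))"
        unfolding Q_def by (intro continuous_intros continuous_on_poly_eval2)
      then obtain y where "y \<in> Y2" "\<forall>x\<in>Y2. norm (Q y) \<le> norm (Q x)"
        using continuous_attains_inf[OF \<open>compact Y2\<close> False] by blast
      then show ?thesis using that[of "norm (Q y)"] Y2_nz by auto
    qed
    have "z \<in> polynomial_hull Y1"
    proof (rule polynomial_hull_localize[OF \<open>compact X\<close> z XY \<open>Y1 \<noteq> {}\<close>, of "1 / sin \<alpha>"])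
      show "1 / sin \<alpha> > 0" using sin by simp
      fix \<epsilon> :: real assume "\<epsilon> > 0"
      define \<eta> where "\<eta> = \<epsilon> * m * sin \<alpha>"
      have "\<eta> > 0" using \<open>\<epsilon> > 0\<close> m sin by (simp add: \<eta>_def)
      define U where "U = (\<lambda>x. Q x / (of_real \<eta> * cis \<alpha>))"
      have U: "U x \<in> wide_sector \<alpha>" if "x \<in> insert z X" for x
        unfolding U_def using wide_sector_rotate(1)[OF \<alpha> \<open>\<eta> > 0\<close> QY[OF that]] .
      have lower: "sin \<alpha> \<le> norm (1 - U x)" "norm (U x) * sin \<alpha> \<le> norm (1 - U x)"
        if "x \<in> X" for x
        using norm_one_minus_wide_sector_ge[OF \<alpha> U] that by auto
      have "U \<in> polynomial_limits (insert z X)"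
        unfolding U_def
        using polynomial_limits_cmult[OF Q_lim, of "1 / (of_real \<eta> * cis \<alpha>)"] \<open>compact X\<close> by simp
      then have "(\<lambda>x. 1 / (1 - U x)) \<in> polynomial_limits (insert z X)"
        using U \<open>compact X\<close> by (intro polynomial_limits_wide_sector(2)[OF \<alpha>]) auto
      moreover have "norm (1 / (1 - U x)) \<le> 1 / sin \<alpha>" if "x \<in> Y1" for x
        using norm_resolvent_wide_sector_le[OF \<alpha> U] that XY by blast
      moreover have "norm (1 / (1 - U x)) \<le> \<epsilon>" if "x \<in> Y2" for x
      proof -
        have "1 / \<epsilon> = m / \<eta> * sin \<alpha>"
          using m sin \<open>\<epsilon> > 0\<close> by (simp add: \<eta>_def)
        also have "\<dots> \<le> norm (U x) * sin \<alpha>"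
          using m(2)[OF that] \<open>\<eta> > 0\<close> sin
          by (intro mult_right_mono) (auto simp: U_def norm_divide norm_mult intro!: divide_right_mono)
        also have "\<dots> \<le> norm (1 - U x)" using lower(2)[of x] that XY by auto
        finally have "1 / norm (1 - U x) \<le> 1 / (1 / \<epsilon>)"
          using \<open>\<epsilon> > 0\<close> by (intro frac_le) auto
        then show ?thesis by (simp add: norm_divide)
      qed
      moreover have "1/2 \<le> norm (1 / (1 - U z))" using \<open>poly_eval2 q z = 0\<close> by (simp add: U_def Q_def)
      ultimately show "\<exists>F\<in>polynomial_limits (insert z X). (\<forall>x\<in>Y1. norm (F x) \<le> 1 / sin \<alpha>) \<and>
          (\<forall>x\<in>Y2. norm (F x) \<le> \<epsilon>) \<and> 1/2 \<le> norm (F z)"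
        by (intro bexI[of _ "\<lambda>x. 1 / (1 - U x)"]) auto
    qed
    then show "norm (poly_eval2 f z) \<le> d + e"
      unfolding polynomial_hull_def Y1_def by blast
  qed
qed

text \<open>Here \<open>K \<eta>\<close> stands for the transition function of \<open>Q\<close> or for its complement to \<open>1\<close>.  Its
  decay on \<open>X2\<close> is lost where \<open>Q\<close> is close to zero.  The factor \<open>T = 1 - 1 / (1 - Q / c)\<close> with
  \<open>c\<close> of modulus \<open>\<eta>\<close> repairs this: it is bounded, of size at most a multiple of \<open>norm (Q x) / \<eta>\<close>,
  and tends to \<open>1\<close> where \<open>Q\<close> is nonzero.  Combined with \<open>K (\<eta>\<^sup>2)\<close> it leaves a factor
  \<open>\<eta>\<^sup>2 / \<eta> = \<eta>\<close> on \<open>X2\<close>.\<close>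

lemma polynomial_hull_localize_transition:
  assumes "compact X" and z: "z \<in> polynomial_hull X" and X: "X = X1 \<union> X2" "X1 \<noteq> {}"
    and \<alpha>: "0 < \<alpha>" "\<alpha> \<le> pi/2" and Q: "Q \<in> polynomial_limits (insert z X)"
    and QY: "\<And>x. x \<in> insert z X \<Longrightarrow> Q x \<in> of_real ` {0..} \<union> wide_sector (2 * \<alpha>)"
    and "Q z \<noteq> 0" and "C > 0"
    and K: "\<And>\<eta>. \<eta> > 0 \<Longrightarrow> K \<eta> \<in> polynomial_limits (insert z X)"
    and K1: "\<And>\<eta> x. \<eta> > 0 \<Longrightarrow> x \<in> X1 \<Longrightarrow> norm (K \<eta> x) \<le> C"
    and K2: "\<And>\<eta> x. \<eta> > 0 \<Longrightarrow> x \<in> X2 \<Longrightarrow> norm (Q x) * norm (K \<eta> x) \<le> C * \<eta>"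
    and Kz: "\<And>\<eta>. \<eta> > 0 \<Longrightarrow> norm (Q z) * norm (K \<eta> z - 1) \<le> C * \<eta>"
  shows "z \<in> polynomial_hull X1"
proof -
  have sin: "sin \<alpha> > 0" using \<alpha> by (intro sin_gt_zero) auto
  define A where "A = C * (1 + 1 / sin \<alpha>)"
  have "A > 0" using \<open>C > 0\<close> sin by (simp add: A_def add_pos_pos)
  moreover have "\<exists>F\<in>polynomial_limits (insert z X).
      (\<forall>x\<in>X1. norm (F x) \<le> A) \<and> (\<forall>x\<in>X2. norm (F x) \<le> \<epsilon>) \<and> 1/2 \<le> norm (F z)" if "\<epsilon> > 0" for \<epsilon>
  proof -
    define v where "v = norm (Q z)"
    have "v > 0" using \<open>Q z \<noteq> 0\<close> by (simp add: v_def)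
    \<comment> \<open>The second entry makes F small on X2; the last two make both factors at least 3/4 at z.\<close>
    define \<eta> where "\<eta> = Min {1, \<epsilon> * sin \<alpha> / C, v / (4 * C), v * sin \<alpha> / 4}"
    have \<eta>: "\<eta> > 0" "\<eta> \<le> 1" "\<eta> \<le> \<epsilon> * sin \<alpha> / C" "\<eta> \<le> v / (4 * C)" "\<eta> \<le> v * sin \<alpha> / 4"
    proof -
      show "\<eta> > 0"
        unfolding \<eta>_def using \<open>\<epsilon> > 0\<close> \<open>C > 0\<close> \<open>v > 0\<close> sin by (subst Min_gr_iff) auto
      show "\<eta> \<le> 1" "\<eta> \<le> \<epsilon> * sin \<alpha> / C" "\<eta> \<le> v / (4 * C)" "\<eta> \<le> v * sin \<alpha> / 4"
        unfolding \<eta>_def by (rule Min_le; simp)+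
    qed
    define U where "U = (\<lambda>x. Q x / (of_real \<eta> * cis \<alpha>))"
    define T where "T = (\<lambda>x. 1 - 1 / (1 - U x))"
    have nU: "norm (U x) = norm (Q x) / \<eta>" for x
      using \<eta>(1) by (simp add: U_def norm_divide norm_mult)
    have U: "U x \<in> wide_sector \<alpha>" if "x \<in> insert z X" for x
      unfolding U_def using wide_sector_rotate(1)[OF \<alpha> \<eta>(1) QY[OF that]] .
    have lower: "sin \<alpha> \<le> norm (1 - U x)" "norm (U x) * sin \<alpha> \<le> norm (1 - U x)" if "x \<in> insert z X" for x
      using norm_one_minus_wide_sector_ge[OF \<alpha> U[OF that]] by auto
    have res: "norm (1 / (1 - U x)) \<le> 1 / sin \<alpha>" if "x \<in> insert z X" for x
      using norm_resolvent_wide_sector_le[OF \<alpha> U[OF that]] .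
    have T1: "norm (T x) \<le> 1 + 1 / sin \<alpha>" if "x \<in> insert z X" for x
      using norm_triangle_ineq4[of 1 "1 / (1 - U x)"] res[OF that] by (simp add: T_def)
    have T2: "norm (T x) \<le> norm (Q x) / (\<eta> * sin \<alpha>)" if "x \<in> insert z X" for x
    proof -
      have "1 - U x \<noteq> 0" using lower(1)[OF that] sin by auto
      then have "T x = - (U x * (1 / (1 - U x)))" by (simp add: T_def field_simps)
      then have "norm (T x) = norm (U x) * norm (1 / (1 - U x))" by (simp add: norm_mult norm_divide)
      also have "\<dots> \<le> norm (U x) * (1 / sin \<alpha>)" using res[OF that] by (intro mult_left_mono) auto
      also have "\<dots> = norm (Q x) / (\<eta> * sin \<alpha>)" by (simp add: nU)
      finally show ?thesis .
    qed
    define F where "F = (\<lambda>x. K (\<eta>\<^sup>2) x * T x)"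
    have \<eta>2: "\<eta>\<^sup>2 > 0" using \<eta> by simp
    have "U \<in> polynomial_limits (insert z X)"
      unfolding U_def using polynomial_limits_cmult[OF Q, of "1 / (of_real \<eta> * cis \<alpha>)"] \<open>compact X\<close> by simp
    then have "(\<lambda>x. 1 / (1 - U x)) \<in> polynomial_limits (insert z X)"
      using U \<open>compact X\<close> by (intro polynomial_limits_wide_sector(2)[OF \<alpha>]) auto
    then have "F \<in> polynomial_limits (insert z X)"
      unfolding F_def T_def using K[OF \<eta>2] \<open>compact X\<close>
      by (intro polynomial_limits_mult polynomial_limits_diff polynomial_limits_const) auto
    moreover have "norm (F x) \<le> A" if "x \<in> X1" for x
      unfolding F_def A_def norm_mult
      using K1[OF \<eta>2 that] T1[of x] that X \<open>C > 0\<close> by (intro mult_mono) auto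
    moreover have "norm (F x) \<le> \<epsilon>" if "x \<in> X2" for x
    proof -
      have "norm (F x) \<le> norm (K (\<eta>\<^sup>2) x) * (norm (Q x) / (\<eta> * sin \<alpha>))"
        unfolding F_def norm_mult using T2[of x] that X by (intro mult_left_mono) auto
      also have "\<dots> = (norm (Q x) * norm (K (\<eta>\<^sup>2) x)) / (\<eta> * sin \<alpha>)" by simp
      also have "\<dots> \<le> (C * \<eta>\<^sup>2) / (\<eta> * sin \<alpha>)"
        using K2[OF \<eta>2 that] \<eta>(1) sin by (intro divide_right_mono) auto
      also have "\<dots> = \<eta> * C / sin \<alpha>" using \<eta>(1) by (simp add: power2_eq_square)
      also have "\<dots> \<le> \<epsilon>" using \<eta>(3) \<open>C > 0\<close> sin by (simp add: field_simps)
      finally show ?thesis .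
    qed
    moreover have "1/2 \<le> norm (F z)"
    proof -
      have "v * norm (K (\<eta>\<^sup>2) z - 1) \<le> C * \<eta>\<^sup>2" using Kz[OF \<eta>2] by (simp add: v_def)
      also have "\<dots> \<le> C * \<eta>" using \<eta>(1,2) \<open>C > 0\<close> by (simp add: power2_eq_square mult_left_le)
      also have "\<dots> \<le> v / 4" using \<eta>(4) \<open>C > 0\<close> by (simp add: field_simps)
      finally have "norm (K (\<eta>\<^sup>2) z - 1) \<le> 1/4" using \<open>v > 0\<close> by simp
      then have Kz': "3/4 \<le> norm (K (\<eta>\<^sup>2) z)"
        using norm_triangle_ineq2[of 1 "1 - K (\<eta>\<^sup>2) z"] by (simp add: norm_minus_commute)
      have "(v / \<eta>) * sin \<alpha> \<le> norm (1 - U z)" using lower(2)[of z] by (simp add: nU v_def)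
      moreover have "4 \<le> (v / \<eta>) * sin \<alpha>" using \<eta>(1,5) by (simp add: field_simps)
      ultimately have "4 \<le> norm (1 - U z)" by linarith
      then have "norm (1 / (1 - U z)) \<le> 1/4"
        unfolding norm_divide norm_one by (intro frac_le) auto
      then have "3/4 \<le> norm (T z)"
        using norm_triangle_ineq2[of 1 "1 / (1 - U z)"] by (simp add: T_def)
      then have "(3/4) * (3/4) \<le> norm (F z)"
        unfolding F_def norm_mult using Kz' by (intro mult_mono) auto
      then show ?thesis by simp
    qed
    ultimately show ?thesis by blast
  qed
  ultimately show ?thesis
    using polynomial_hull_localize[OF \<open>compact X\<close> z X] by blast
qed

text \<open>Squaring doubles the argument and identifies the two halves of the double sector.\<close>

lemma square_in_wide_sector:
  assumes "0 < c" "c \<le> 1" "c * norm w \<le> \<bar>Im w\<bar>"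
  shows "w\<^sup>2 \<in> wide_sector (2 * arcsin c)"
proof -
  have upper: "w\<^sup>2 \<in> wide_sector (2 * arcsin c)" if "c * norm w \<le> Im w" for w
  proof (cases "w = 0")
    case True
    have "2 * arcsin c \<le> pi" using arcsin_ubound[of c] assms by simp
    then show ?thesis using True unfolding wide_sector_def by (auto intro!: exI[of _ 0] exI[of _ pi])
  next
    case False
    define \<tau> where "\<tau> = Arg w"
    have w: "w = of_real (norm w) * cis \<tau>"
      using rcis_cmod_Arg[of w] by (simp add: \<tau>_def rcis_def)
    have "0 \<le> c * norm w" using assms by simp
    then have "Im w \<ge> 0" using that by linarith
    then have \<tau>: "0 \<le> \<tau>" "\<tau> \<le> pi"
      using Im_Ln_pos_le[OF False] Arg_eq_Im_Ln[OF False] by (auto simp: \<tau>_def)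
    have "Im w = norm w * sin \<tau>" by (subst w) simp
    then have "c \<le> sin \<tau>" using that False by (simp add: mult.commute)
    have le: "arcsin c \<le> \<sigma>" if "0 \<le> \<sigma>" "c \<le> sin \<sigma>" for \<sigma>
    proof (cases "\<sigma> \<le> pi / 2")
      case True
      have "arcsin c \<le> arcsin (sin \<sigma>)" using that assms by (intro arcsin_le_arcsin) auto
      also have "\<dots> = \<sigma>" using True that by (intro arcsin_sin) auto
      finally show ?thesis .
    next
      case False
      then show ?thesis using arcsin_ubound[of c] assms by simp
    qed
    have "arcsin c \<le> \<tau>" "arcsin c \<le> pi - \<tau>"
      using le[of \<tau>] le[of "pi - \<tau>"] \<tau> \<open>c \<le> sin \<tau>\<close> by auto
    moreover have "w\<^sup>2 = of_real ((norm w)\<^sup>2) * cis (2 * \<tau>)"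
      by (subst w) (simp add: power_mult_distrib power2_eq_square cis_mult)
    moreover have "(norm w)\<^sup>2 \<ge> 0" by simp
    moreover have "2 * arcsin c \<le> 2 * \<tau>" "2 * \<tau> \<le> 2 * pi - 2 * arcsin c"
      using calculation by simp_all
    ultimately show ?thesis
      unfolding wide_sector_def by blast
  qed
  show ?thesis
    using upper[of w] upper[of "- w"] assms(3) by (cases "Im w \<ge> 0") auto
qed

text \<open>The value \<open>w = p z\<close> decides which of the two sets has \<open>z\<close> in its hull: \<open>X1\<close> if \<open>w\<close> is real, and
  \<open>X2\<close> otherwise.  In the second case \<open>w\<close> need not lie in the given double sector, and the sector is
  enlarged to contain it.\<close>

theorem Kallin_real_axis:
  assumes "compact X1" "compact X2" "X1 \<noteq> {}" "X2 \<noteq> {}"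
    and hull1: "polynomial_hull X1 \<subseteq> X1" and hull2: "polynomial_hull X2 \<subseteq> X2"
    and p1: "\<And>x. x \<in> X1 \<Longrightarrow> poly_eval2 p x \<in> \<real>"
    and "c > 0" and p2: "\<And>x. x \<in> X2 \<Longrightarrow> c * norm (poly_eval2 p x) \<le> \<bar>Im (poly_eval2 p x)\<bar>"
    and zero: "\<And>x. x \<in> X2 \<Longrightarrow> poly_eval2 p x = 0 \<Longrightarrow> x \<in> X1"
  shows "polynomial_hull (X1 \<union> X2) \<subseteq> X1 \<union> X2"
proof
  fix z assume z: "z \<in> polynomial_hull (X1 \<union> X2)"
  define w where "w = poly_eval2 p z"
  define X where "X = X1 \<union> X2"
  have "compact X" unfolding X_def using assms(1,2) by (rule compact_Un)
  have z: "z \<in> polynomial_hull X" using z by (simp add: X_def)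
  define b where "b = (if Im w = 0 then min c 1 else min (min c 1) (\<bar>Im w\<bar> / norm w))"
  have b: "0 < b" "b \<le> 1" "b \<le> c" "Im w \<noteq> 0 \<Longrightarrow> b * norm w \<le> \<bar>Im w\<bar>"
  proof -
    have w: "w \<noteq> 0" if "Im w \<noteq> 0" using that by auto
    then show "0 < b" "b \<le> 1" "b \<le> c"
      using \<open>c > 0\<close> by (auto simp: b_def min.coboundedI1)
    show "b * norm w \<le> \<bar>Im w\<bar>" if "Im w \<noteq> 0"
    proof -
      have "b \<le> \<bar>Im w\<bar> / norm w" using that by (simp add: b_def)
      then show ?thesis using w[OF that] by (simp add: pos_le_divide_eq)
    qed
  qed
  define \<alpha> where "\<alpha> = arcsin b"
  have \<alpha>: "0 < \<alpha>" "\<alpha> \<le> pi / 2"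
    using b arcsin_less_arcsin[of 0 b] arcsin_ubound[of b] by (auto simp: \<alpha>_def)
  have sin: "sin \<alpha> > 0" using \<alpha> by (intro sin_gt_zero) auto
  define Q where "Q = poly_eval2 (p\<^sup>2)"
  have Q: "Q x = (poly_eval2 p x)\<^sup>2" for x by (simp add: Q_def poly_eval2_power)
  have Q_lim: "Q \<in> polynomial_limits (insert z X)" by (simp add: Q_def polynomial_limits_poly)
  have real_sq: "u\<^sup>2 \<in> of_real ` {0..}" if "Im u = 0" for u
  proof -
    have "u = of_real (Re u)" using that by (simp add: complex_eq_iff)
    then have "u\<^sup>2 = of_real ((Re u)\<^sup>2)" by (metis of_real_power)
    then show ?thesis by (rule image_eqI) simp
  qed
  have Q1: "Q x \<in> of_real ` {0..}" if "x \<in> X1" for x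
    using real_sq p1[OF that] by (simp add: Q complex_is_Real_iff)
  have Q2: "Q x \<in> wide_sector (2 * \<alpha>)" if "x \<in> X2" for x
    unfolding Q \<alpha>_def
  proof (rule square_in_wide_sector[OF b(1,2)])
    have "b * norm (poly_eval2 p x) \<le> c * norm (poly_eval2 p x)"
      using b(3) by (rule mult_right_mono) simp
    then show "b * norm (poly_eval2 p x) \<le> \<bar>Im (poly_eval2 p x)\<bar>" using p2[OF that] by linarith
  qed
  have Qz: "if Im w = 0 then Q z \<in> of_real ` {0..} else Q z \<in> wide_sector (2 * \<alpha>)"
    using real_sq[of w] square_in_wide_sector[OF b(1,2), of w] b(4) by (auto simp: Q w_def \<alpha>_def)
  have QY: "Q x \<in> of_real ` {0..} \<union> wide_sector (2 * \<alpha>)" if "x \<in> insert z X" for x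
    using that Q1 Q2 Qz by (auto simp: X_def split: if_splits)
  obtain C where "C > 0"
    and C1: "\<And>\<eta> v. \<lbrakk>\<eta> > 0; v \<in> of_real ` {0..}\<rbrakk> \<Longrightarrow> norm (transition \<alpha> \<eta> v - 1) \<le> C"
      "\<And>\<eta> v. \<lbrakk>\<eta> > 0; v \<in> of_real ` {0..}\<rbrakk> \<Longrightarrow> norm v * norm (transition \<alpha> \<eta> v - 1) \<le> C * \<eta>"
    and C2: "\<And>\<eta> v. \<lbrakk>\<eta> > 0; v \<in> wide_sector (2 * \<alpha>)\<rbrakk> \<Longrightarrow> norm (transition \<alpha> \<eta> v) \<le> C"
      "\<And>\<eta> v. \<lbrakk>\<eta> > 0; v \<in> wide_sector (2 * \<alpha>)\<rbrakk> \<Longrightarrow> norm v * norm (transition \<alpha> \<eta> v) \<le> C * \<eta>"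
  proof (rule transition_asymptotics[OF \<alpha>])
    fix C assume *: "C > 0"
      "\<And>\<eta> \<rho>. \<lbrakk>\<eta> > 0; \<rho> \<ge> 0\<rbrakk> \<Longrightarrow> norm (transition \<alpha> \<eta> (of_real \<rho>) - 1) \<le> C"
      "\<And>\<eta> \<rho>. \<lbrakk>\<eta> > 0; \<rho> \<ge> 0\<rbrakk> \<Longrightarrow> \<rho> * norm (transition \<alpha> \<eta> (of_real \<rho>) - 1) \<le> C * \<eta>"
      "\<And>\<eta> v. \<lbrakk>\<eta> > 0; v \<in> wide_sector (2 * \<alpha>)\<rbrakk> \<Longrightarrow> norm (transition \<alpha> \<eta> v) \<le> C"
      "\<And>\<eta> v. \<lbrakk>\<eta> > 0; v \<in> wide_sector (2 * \<alpha>)\<rbrakk> \<Longrightarrow> norm v * norm (transition \<alpha> \<eta> v) \<le> C * \<eta>"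
    show thesis
    proof (rule that[OF *(1) _ _ *(4,5)])
      show "norm (transition \<alpha> \<eta> v - 1) \<le> C" if "\<eta> > 0" "v \<in> of_real ` {0..}" for \<eta> v
        using *(2)[OF that(1)] that(2) by auto
      show "norm v * norm (transition \<alpha> \<eta> v - 1) \<le> C * \<eta>" if "\<eta> > 0" "v \<in> of_real ` {0..}" for \<eta> v
        using *(3)[OF that(1)] that(2) by auto
    qed
  qed
  have trans: "(\<lambda>x. transition \<alpha> \<eta> (Q x)) \<in> polynomial_limits (insert z X)" if "\<eta> > 0" for \<eta>
    using \<open>compact X\<close> QY by (intro polynomial_limits_transition[OF \<alpha> that _ Q_lim]) auto
  consider "Q z = 0" | "Q z \<noteq> 0" "Im w = 0" | "Q z \<noteq> 0" "Im w \<noteq> 0" by blast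
  then show "z \<in> X1 \<union> X2"
  proof cases
    case 1
    then have "z \<in> polynomial_hull X1"
      using zero unfolding Q_def
      by (intro polynomial_hull_localize_zero[OF \<open>compact X\<close> z X_def \<open>X1 \<noteq> {}\<close> \<alpha> QY[unfolded Q_def]])
         (auto simp: poly_eval2_power)
    then show ?thesis using hull1 by blast
  next
    case 2
    have "z \<in> polynomial_hull X1"
    proof (rule polynomial_hull_localize_transition[OF \<open>compact X\<close> z X_def \<open>X1 \<noteq> {}\<close> \<alpha> Q_lim QY 2(1)])
      show "C + 1 > 0" using \<open>C > 0\<close> by simp
      show "(\<lambda>x. transition \<alpha> \<eta> (Q x)) \<in> polynomial_limits (insert z X)" if "\<eta> > 0" for \<eta>
        using trans[OF that] .
      show "norm (transition \<alpha> \<eta> (Q x)) \<le> C + 1" if "\<eta> > 0" "x \<in> X1" for \<eta> x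
        using C1(1)[OF that(1) Q1[OF that(2)]] norm_triangle_ineq[of "transition \<alpha> \<eta> (Q x) - 1" 1] by simp
      show "norm (Q x) * norm (transition \<alpha> \<eta> (Q x)) \<le> (C + 1) * \<eta>" if "\<eta> > 0" "x \<in> X2" for \<eta> x
        using C2(2)[OF that(1) Q2[OF that(2)]] that(1) by (simp add: distrib_right)
      show "norm (Q z) * norm (transition \<alpha> \<eta> (Q z) - 1) \<le> (C + 1) * \<eta>" if "\<eta> > 0" for \<eta>
        using C1(2)[OF that, of "Q z"] Qz 2 that by (simp add: distrib_right)
    qed
    then show ?thesis using hull1 by blast
  next
    case 3
    have X': "X = X2 \<union> X1" by (auto simp: X_def)
    have "z \<in> polynomial_hull X2"
    proof (rule polynomial_hull_localize_transition[OF \<open>compact X\<close> z X' \<open>X2 \<noteq> {}\<close> \<alpha> Q_lim QY 3(1)])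
      show "C + 1 > 0" using \<open>C > 0\<close> by simp
      show "(\<lambda>x. 1 - transition \<alpha> \<eta> (Q x)) \<in> polynomial_limits (insert z X)" if "\<eta> > 0" for \<eta>
        using trans[OF that] \<open>compact X\<close> by (intro polynomial_limits_diff polynomial_limits_const) auto
      show "norm (1 - transition \<alpha> \<eta> (Q x)) \<le> C + 1" if "\<eta> > 0" "x \<in> X2" for \<eta> x
        using C2(1)[OF that(1) Q2[OF that(2)]] norm_triangle_ineq4[of 1 "transition \<alpha> \<eta> (Q x)"] by simp
      show "norm (Q x) * norm (1 - transition \<alpha> \<eta> (Q x)) \<le> (C + 1) * \<eta>" if "\<eta> > 0" "x \<in> X1" for \<eta> x
        using C1(2)[OF that(1) Q1[OF that(2)]] that(1) by (simp add: distrib_right norm_minus_commute)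
      show "norm (Q z) * norm (1 - transition \<alpha> \<eta> (Q z) - 1) \<le> (C + 1) * \<eta>" if "\<eta> > 0" for \<eta>
        using C2(2)[OF that, of "Q z"] Qz 3 that by (simp add: distrib_right)
    qed
    then show ?thesis using hull2 by blast
  qed
qed

section \<open>Three totally real planes\<close>

lemma closed_real_plane: "closed real_plane"
proof -
  have "real_plane = {z. \<forall>j. Im (z $ j) = 0}"
    by (simp add: real_plane_def complex_is_Real_iff)
  moreover have "closed \<dots>"
    by (intro closed_Collect_all closed_Collect_eq continuous_intros)
  ultimately show ?thesis by simp
qed

lemma norm_squared_vec_2: "(norm (z :: complex ^ 2))\<^sup>2 = (norm (z $ 1))\<^sup>2 + (norm (z $ 2))\<^sup>2"
  by (simp add: norm_vec_def L2_set_def sum_2)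

text \<open>If a point \<open>z\<close> of the hull had a nonzero imaginary part \<open>y\<close>, the Gaussian centred at the real part
  of \<open>z\<close> would take the value \<open>exp (norm y ^ 2) > 1\<close> there, but it is bounded by \<open>1\<close> on real points.
  For real points, the modulus of \<open>z\<^sub>1\<^sup>2 + z\<^sub>2\<^sup>2\<close> is the square of the norm, which
  bounds the norm of \<open>z\<close> by \<open>r\<close>.\<close>

lemma polynomial_hull_real_disc:
  "polynomial_hull (real_plane \<inter> cball 0 r) \<subseteq> real_plane \<inter> cball 0 r" (is "polynomial_hull ?X \<subseteq> _")
proof
  fix z assume z: "z \<in> polynomial_hull ?X"
  have "compact ?X" by (intro closed_Int_compact closed_real_plane compact_cball)
  have nonneg: "r \<ge> 0"
  proof (rule ccontr)
    assume "\<not> r \<ge> 0"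
    then have "?X = {}" by simp
    \<comment> \<open>The hull of the empty set is empty: on it every bound holds vacuously.\<close>
    then have "norm (poly_eval2 0 z) \<le> -1" using z unfolding polynomial_hull_def by blast
    then show False using norm_ge_zero[of "poly_eval2 0 z"] by linarith
  qed
  define p where "p = [:[:0, 1:]:] - [:[:complex_of_real (Re (z $ 1)):]:]"
  define q where "q = [:0, 1:] - [:[:complex_of_real (Re (z $ 2)):]:]"
  have pq: "poly_eval2 (p * p + q * q) x
      = (x $ 1 - of_real (Re (z $ 1)))\<^sup>2 + (x $ 2 - of_real (Re (z $ 2)))\<^sup>2" for x
    by (simp add: p_def q_def poly_eval2_def power2_eq_square algebra_simps)
  define F where "F = (\<lambda>x. exp (- 1 * poly_eval2 (p * p + q * q) x))"
  have "F \<in> polynomial_limits (insert z ?X)"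
    unfolding F_def using \<open>compact ?X\<close>
    by (intro polynomial_limits_exp polynomial_limits_cmult polynomial_limits_poly) auto
  moreover have "norm (F x) \<le> 1" if "x \<in> ?X" for x
  proof -
    have "Im (x $ 1) = 0" "Im (x $ 2) = 0"
      using that by (auto simp: real_plane_def complex_is_Real_iff)
    then show ?thesis by (simp add: F_def pq power2_eq_square)
  qed
  ultimately have "norm (F z) \<le> 1" by (rule polynomial_hull_limit_bound[OF z])
  moreover have "Re (- 1 * poly_eval2 (p * p + q * q) z) = (Im (z $ 1))\<^sup>2 + (Im (z $ 2))\<^sup>2"
    by (simp add: pq power2_eq_square)
  ultimately have "(Im (z $ 1))\<^sup>2 + (Im (z $ 2))\<^sup>2 \<le> 0" by (simp add: F_def)
  then have Im: "Im (z $ 1) = 0" "Im (z $ 2) = 0"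
    by (simp_all add: sum_power2_le_zero_iff)
  have real: "norm (poly_eval2 ([:[:0, 1:]:]\<^sup>2 + [:0, 1:]\<^sup>2) x) = (norm x)\<^sup>2"
    if "Im (x $ 1) = 0" "Im (x $ 2) = 0" for x
  proof -
    have x: "x $ 1 = of_real (Re (x $ 1))" "x $ 2 = of_real (Re (x $ 2))"
      using that by (simp_all add: complex_eq_iff)
    have "poly_eval2 ([:[:0, 1:]:]\<^sup>2 + [:0, 1:]\<^sup>2) x = (x $ 1)\<^sup>2 + (x $ 2)\<^sup>2"
      by (simp only: poly_eval2_add poly_eval2_power poly_eval2_fst poly_eval2_snd)
    also have "\<dots> = of_real ((Re (x $ 1))\<^sup>2 + (Re (x $ 2))\<^sup>2)"
      by (subst x(1), subst x(2)) simp
    also have "norm \<dots> = (norm x)\<^sup>2"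
      using that unfolding norm_squared_vec_2 norm_of_real by (simp add: cmod_power2)
    finally show ?thesis .
  qed
  have "norm (poly_eval2 ([:[:0, 1:]:]\<^sup>2 + [:0, 1:]\<^sup>2) x) \<le> r\<^sup>2" if "x \<in> ?X" for x
  proof -
    have "Im (x $ 1) = 0" "Im (x $ 2) = 0" "norm x \<le> r"
      using that by (auto simp: real_plane_def complex_is_Real_iff)
    then show ?thesis using real[of x] by (simp add: power_mono)
  qed
  then have "norm (poly_eval2 ([:[:0, 1:]:]\<^sup>2 + [:0, 1:]\<^sup>2) z) \<le> r\<^sup>2"
    using z unfolding polynomial_hull_def by blast
  then have "(norm z)\<^sup>2 \<le> r\<^sup>2" using real[OF Im] by simp
  then have "norm z \<le> r" using nonneg by (rule power2_le_imp_le)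
  moreover have "\<forall>j. z $ j \<in> \<real>" using Im by (simp add: forall_2 complex_is_Real_iff)
  ultimately show "z \<in> ?X" by (simp add: real_plane_def)
qed

lemma graph_planeE:
  assumes "z \<in> graph_plane A"
  obtains s t where "z $ 1 = of_real (A $ 1 $ 1 * s + A $ 1 $ 2 * t) + \<i> * of_real s"
    and "z $ 2 = of_real (A $ 2 $ 1 * s + A $ 2 $ 2 * t) + \<i> * of_real t"
proof -
  obtain x where x: "x \<in> real_plane" "z = (map_matrix complex_of_real A + mat \<i>) *v x"
    using assms unfolding graph_plane_def by blast
  obtain s t where st: "x $ 1 = of_real s" "x $ 2 = of_real t"
    using x(1) unfolding real_plane_def by (metis (mono_tags) Reals_cases mem_Collect_eq)
  show ?thesis
    by (rule that[of s t])
       (simp_all add: x(2) matrix_vector_mult_def sum_2 st map_matrix_def mat_def algebra_simps)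
qed

text \<open>An eigenvalue of a definite symmetric matrix \<open>M\<close> has absolute value at least \<open>det M\<close> divided by
  the absolute value of the trace, which bounds the other eigenvalue.  The
  gap in the inequality with the trace is the square of the norm of \<open>M (s, t)\<close>, by the theorem of Cayley and Hamilton.\<close>

lemma definite_binary_form_bound:
  fixes m n l s t :: real
  shows "(m * l - n\<^sup>2) * (s\<^sup>2 + t\<^sup>2) \<le> \<bar>m + l\<bar> * \<bar>m * s\<^sup>2 + 2 * n * s * t + l * t\<^sup>2\<bar>"
proof -
  have "(m + l) * (m * s\<^sup>2 + 2 * n * s * t + l * t\<^sup>2) - (m * l - n\<^sup>2) * (s\<^sup>2 + t\<^sup>2)
      = (m * s + n * t)\<^sup>2 + (n * s + l * t)\<^sup>2"
    by (simp add: power2_eq_square algebra_simps)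
  moreover have "0 \<le> (m * s + n * t)\<^sup>2 + (n * s + l * t)\<^sup>2" by simp
  moreover have "(m + l) * (m * s\<^sup>2 + 2 * n * s * t + l * t\<^sup>2)
      \<le> \<bar>m + l\<bar> * \<bar>m * s\<^sup>2 + 2 * n * s * t + l * t\<^sup>2\<bar>"
    by (metis abs_ge_self abs_mult)
  ultimately show ?thesis by linarith
qed

definition binary_form :: "real \<Rightarrow> real \<Rightarrow> real \<Rightarrow> complex poly poly" where
  "binary_form a b d =
     [:[:0, 0, of_real a:], [:0, of_real (2 * b):], [:of_real d:]:]"

lemma poly_eval2_binary_form:
  "poly_eval2 (binary_form a b d) z
     = of_real a * (z $ 1)\<^sup>2 + of_real (2 * b) * (z $ 1 * z $ 2) + of_real d * (z $ 2)\<^sup>2"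
  by (simp add: poly_eval2_def binary_form_def power2_eq_square algebra_simps)

text \<open>Let \<open>S\<close> be the symmetric matrix with rows \<open>(a, b)\<close> and \<open>(b, d)\<close>.  The first hypothesis says that
  \<open>S A\<close> is symmetric, so that the imaginary part of the form at \<open>(A + i I) x\<close> is \<open>2 x\<^sup>T S A x\<close>; the
  second makes this real form definite.  The entries of \<open>S A\<close> are \<open>m\<close>, \<open>n\<close> and \<open>l\<close>.  Both the form and
  its imaginary part are quadratic in \<open>x\<close>, and they are compared through the square \<open>R\<close> of the norm
  of \<open>x\<close>.\<close>

lemma binary_form_graph_plane:
  fixes A :: "real ^ 2 ^ 2"
  assumes sym: "a * A $ 1 $ 2 + b * A $ 2 $ 2 = b * A $ 1 $ 1 + d * A $ 2 $ 1"
    and pos: "(a * d - b\<^sup>2) * det A > 0"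
  obtains c where "c > 0"
    and "\<And>z. z \<in> graph_plane A \<Longrightarrow>
      c * norm (poly_eval2 (binary_form a b d) z) \<le> \<bar>Im (poly_eval2 (binary_form a b d) z)\<bar>"
    and "\<And>z. z \<in> graph_plane A \<Longrightarrow> poly_eval2 (binary_form a b d) z = 0 \<Longrightarrow> z = 0"
proof -
  define m where "m = a * A $ 1 $ 1 + b * A $ 2 $ 1"
  define n where "n = a * A $ 1 $ 2 + b * A $ 2 $ 2"
  define l where "l = b * A $ 1 $ 2 + d * A $ 2 $ 2"
  define D where "D = m * l - n\<^sup>2"
  have n': "n = b * A $ 1 $ 1 + d * A $ 2 $ 1" using sym by (simp add: n_def)
  have "n\<^sup>2 = (a * A $ 1 $ 2 + b * A $ 2 $ 2) * (b * A $ 1 $ 1 + d * A $ 2 $ 1)"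
    unfolding power2_eq_square by (subst n', subst n_def) (rule mult.commute)
  then have "D = (a * d - b\<^sup>2) * det A"
    by (simp add: D_def m_def l_def det_2 power2_eq_square algebra_simps)
  then have "D > 0" using pos by simp
  define K where "K = \<bar>A $ 1 $ 1\<bar> + \<bar>A $ 1 $ 2\<bar> + \<bar>A $ 2 $ 1\<bar> + \<bar>A $ 2 $ 2\<bar> + 1"
  define N where "N = \<bar>a\<bar> + 2 * \<bar>b\<bar> + \<bar>d\<bar>"
  define c where "c = 2 * D / ((\<bar>m + l\<bar> + 1) * (N * K\<^sup>2 + 1))"
  have "N * K\<^sup>2 + 1 > 0" by (simp add: N_def add_nonneg_pos)
  then have "c > 0" using \<open>D > 0\<close> by (simp add: c_def add_nonneg_pos)
  have main: "c * norm (poly_eval2 (binary_form a b d) z) \<le> \<bar>Im (poly_eval2 (binary_form a b d) z)\<bar>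
      \<and> (poly_eval2 (binary_form a b d) z = 0 \<longrightarrow> z = 0)" if z: "z \<in> graph_plane A" for z
  proof -
    obtain s t where st: "z $ 1 = of_real (A $ 1 $ 1 * s + A $ 1 $ 2 * t) + \<i> * of_real s"
      "z $ 2 = of_real (A $ 2 $ 1 * s + A $ 2 $ 2 * t) + \<i> * of_real t"
      using graph_planeE[OF z] by metis
    define R where "R = s\<^sup>2 + t\<^sup>2"
    define E where "E = m * s\<^sup>2 + 2 * n * s * t + l * t\<^sup>2"
    define w where "w = poly_eval2 (binary_form a b d) z"
    have "2 * n * s * t = (a * A $ 1 $ 2 + b * A $ 2 $ 2) * s * t + (b * A $ 1 $ 1 + d * A $ 2 $ 1) * s * t"
      using n' n_def by (simp add: algebra_simps)
    then have Im: "Im w = 2 * E"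
      unfolding w_def poly_eval2_binary_form E_def m_def l_def
      by (simp add: st power2_eq_square algebra_simps)
    have "D * R \<le> \<bar>m + l\<bar> * \<bar>E\<bar>"
      using definite_binary_form_bound[of m l n s t] by (simp add: D_def R_def E_def)
    then have DR: "D * R \<le> (\<bar>m + l\<bar> + 1) * \<bar>E\<bar>" by (simp add: distrib_right)
    have "R \<ge> 0" by (simp add: R_def)
    have s: "\<bar>s\<bar> \<le> sqrt R" and t: "\<bar>t\<bar> \<le> sqrt R"
      by (simp_all add: R_def real_le_rsqrt)
    have "norm (z $ j) \<le> K * sqrt R" if "z $ j = of_real (g * s + h * t) + \<i> * of_real e"
      "\<bar>g\<bar> + \<bar>h\<bar> + 1 \<le> K" "\<bar>e\<bar> \<le> sqrt R" for j g h e
    proof -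
      have "norm (z $ j) \<le> \<bar>g * s + h * t\<bar> + \<bar>e\<bar>"
        unfolding that(1) using norm_triangle_ineq[of "complex_of_real (g * s + h * t)" "\<i> * of_real e"]
        by (simp add: norm_mult del: of_real_add of_real_mult)
      also have "\<dots> \<le> \<bar>g\<bar> * \<bar>s\<bar> + \<bar>h\<bar> * \<bar>t\<bar> + \<bar>e\<bar>"
        using abs_triangle_ineq[of "g * s" "h * t"] by (simp add: abs_mult)
      also have "\<dots> \<le> \<bar>g\<bar> * sqrt R + \<bar>h\<bar> * sqrt R + sqrt R"
        using s t that(3) by (intro add_mono mult_left_mono) auto
      also have "\<dots> = (\<bar>g\<bar> + \<bar>h\<bar> + 1) * sqrt R" by (simp add: algebra_simps)
      also have "\<dots> \<le> K * sqrt R" using that(2) \<open>R \<ge> 0\<close> by (intro mult_right_mono) auto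
      finally show ?thesis .
    qed
    from this[OF st(1) _ s] this[OF st(2) _ t]
    have z12: "norm (z $ 1) \<le> K * sqrt R" "norm (z $ 2) \<le> K * sqrt R" by (auto simp: K_def)
    have prod: "norm (z $ i) * norm (z $ j) \<le> K\<^sup>2 * R" if "i \<in> {1, 2}" "j \<in> {1, 2}" for i j
    proof -
      have "norm (z $ i) * norm (z $ j) \<le> (K * sqrt R) * (K * sqrt R)"
        using z12 that by (intro mult_mono) (auto simp: K_def \<open>R \<ge> 0\<close>)
      also have "\<dots> = K\<^sup>2 * R" using \<open>R \<ge> 0\<close> by (simp add: power2_eq_square)
      finally show ?thesis .
    qed
    have "norm w \<le> norm (of_real a * (z $ 1)\<^sup>2) + norm (of_real (2 * b) * (z $ 1 * z $ 2))
        + norm (of_real d * (z $ 2)\<^sup>2)"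
      unfolding w_def poly_eval2_binary_form
      by (intro order_trans[OF norm_triangle_ineq] add_right_mono norm_triangle_ineq)
    also have "\<dots> = \<bar>a\<bar> * (norm (z $ 1) * norm (z $ 1)) + 2 * \<bar>b\<bar> * (norm (z $ 1) * norm (z $ 2))
        + \<bar>d\<bar> * (norm (z $ 2) * norm (z $ 2))"
      by (simp add: norm_mult norm_power power2_eq_square abs_mult)
    also have "\<dots> \<le> \<bar>a\<bar> * (K\<^sup>2 * R) + 2 * \<bar>b\<bar> * (K\<^sup>2 * R) + \<bar>d\<bar> * (K\<^sup>2 * R)"
      by (intro add_mono mult_left_mono prod) auto
    also have "\<dots> = N * K\<^sup>2 * R" by (simp add: N_def algebra_simps)
    also have "\<dots> \<le> (N * K\<^sup>2 + 1) * R" using \<open>R \<ge> 0\<close> by (simp add: distrib_right)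
    finally have "norm w \<le> (N * K\<^sup>2 + 1) * R" .
    then have "c * norm w \<le> c * ((N * K\<^sup>2 + 1) * R)"
      using \<open>c > 0\<close> by (intro mult_left_mono) auto
    also have "\<dots> = 2 * (D * R) / (\<bar>m + l\<bar> + 1)"
      using \<open>N * K\<^sup>2 + 1 > 0\<close> by (simp add: c_def)
    also have "\<dots> \<le> 2 * \<bar>E\<bar>"
    proof -
      have "\<bar>m + l\<bar> + 1 > 0" by simp
      then show ?thesis using DR by (simp add: pos_divide_le_eq mult.commute)
    qed
    finally have "c * norm w \<le> \<bar>Im w\<bar>" by (simp add: Im)
    moreover have "z = 0" if "w = 0"
    proof -
      have "D * R \<le> 0" using that Im DR by simp
      then have "R \<le> 0" using \<open>D > 0\<close> by (simp add: mult_le_0_iff)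
      then have "s = 0" "t = 0" by (simp_all add: R_def sum_power2_le_zero_iff)
      then show ?thesis using st by (simp add: vec_eq_iff forall_2)
    qed
    ultimately show ?thesis by (simp add: w_def)
  qed
  show ?thesis using that[OF \<open>c > 0\<close>] main by blast
qed

theorem theorem3p1:
  fixes A1 A2 :: "real ^ 2 ^ 2"
  assumes "maximal_totally_real real_plane"
    and "maximal_totally_real (graph_plane A1)"
    and "maximal_totally_real (graph_plane A2)"
    and "locally_polynomially_convex_at (real_plane \<union> graph_plane A1) 0"
    and "locally_polynomially_convex_at (real_plane \<union> graph_plane A2) 0"
    and "locally_polynomially_convex_at (graph_plane A1 \<union> graph_plane A2) 0"
    and "det (A1 ** A2 - A2 ** A1) < 0"
    and "det A1 < 0" and "det A2 < 0"
  shows "locally_polynomially_convex_at (real_plane \<union> graph_plane A1 \<union> graph_plane A2) 0"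
proof -
  obtain r where closed12: "closed (graph_plane A1 \<union> graph_plane A2)"
    and in12: "0 \<in> graph_plane A1 \<union> graph_plane A2"
    and "r > 0" and pc: "polynomially_convex ((graph_plane A1 \<union> graph_plane A2) \<inter> cball 0 r)"
    using assms(6) unfolding locally_polynomially_convex_at_def by blast
  define X1 where "X1 = real_plane \<inter> cball 0 r"
  define X2 where "X2 = (graph_plane A1 \<union> graph_plane A2) \<inter> cball 0 r"
  define C where "C = A1 ** A2 - A2 ** A1"
  \<comment> \<open>The symmetric matrix with rows (a, b) and (b, d) is J C, because C has trace zero.\<close>
  define a where "a = C $ 2 $ 1"
  define b where "b = - C $ 1 $ 1"
  define d where "d = - C $ 1 $ 2"
  note entries = C_def a_def b_def d_def matrix_matrix_mult_def sum_2 det_2 power2_eq_square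
  have "a * d - b\<^sup>2 = det C" by (simp add: entries algebra_simps)
  then have neg: "a * d - b\<^sup>2 < 0" using assms(7) by (simp add: C_def)
  \<comment> \<open>Symmetry of J C A for A = A1, A2 means that C A has trace zero.\<close>
  have sym1: "a * A1 $ 1 $ 2 + b * A1 $ 2 $ 2 = b * A1 $ 1 $ 1 + d * A1 $ 2 $ 1"
    by (simp add: entries algebra_simps)
  have sym2: "a * A2 $ 1 $ 2 + b * A2 $ 2 $ 2 = b * A2 $ 1 $ 1 + d * A2 $ 2 $ 1"
    by (simp add: entries algebra_simps)
  define p where "p = poly_eval2 (binary_form a b d)"
  have pos: "(a * d - b\<^sup>2) * det A1 > 0" "(a * d - b\<^sup>2) * det A2 > 0"
    using neg assms(8,9) by (simp_all add: mult_neg_neg)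
  obtain c1 where c1: "c1 > 0" "\<And>z. z \<in> graph_plane A1 \<Longrightarrow> c1 * norm (p z) \<le> \<bar>Im (p z)\<bar>"
      "\<And>z. z \<in> graph_plane A1 \<Longrightarrow> p z = 0 \<Longrightarrow> z = 0"
    using binary_form_graph_plane[OF sym1 pos(1)] unfolding p_def by metis
  obtain c2 where c2: "c2 > 0" "\<And>z. z \<in> graph_plane A2 \<Longrightarrow> c2 * norm (p z) \<le> \<bar>Im (p z)\<bar>"
      "\<And>z. z \<in> graph_plane A2 \<Longrightarrow> p z = 0 \<Longrightarrow> z = 0"
    using binary_form_graph_plane[OF sym2 pos(2)] unfolding p_def by metis
  have "0 \<in> X1" using \<open>r > 0\<close> by (simp add: X1_def real_plane_def)
  have "0 \<in> X2" using in12 \<open>r > 0\<close> by (simp add: X2_def)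
  have X2: "compact X2" "polynomial_hull X2 \<subseteq> X2"
    using pc[folded X2_def] \<open>0 \<in> X2\<close> polynomially_convex_iff[of X2] by blast+
  have X1: "compact X1" "polynomial_hull X1 \<subseteq> X1"
    unfolding X1_def by (intro closed_Int_compact closed_real_plane compact_cball polynomial_hull_real_disc)+
  have "polynomial_hull (X1 \<union> X2) \<subseteq> X1 \<union> X2"
  proof (rule Kallin_real_axis[OF X1(1) X2(1) _ _ X1(2) X2(2), of "binary_form a b d" "min c1 c2", folded p_def])
    show "X1 \<noteq> {}" "X2 \<noteq> {}" using \<open>0 \<in> X1\<close> \<open>0 \<in> X2\<close> by auto
    show "p x \<in> \<real>" if "x \<in> X1" for x
      using that unfolding p_def poly_eval2_binary_form X1_def real_plane_def
      by (auto intro!: Reals_add Reals_mult Reals_power)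
    show "min c1 c2 > 0" using c1(1) c2(1) by simp
    show "min c1 c2 * norm (p x) \<le> \<bar>Im (p x)\<bar>" if "x \<in> X2" for x
    proof -
      have "min c1 c2 * norm (p x) \<le> c1 * norm (p x)" "min c1 c2 * norm (p x) \<le> c2 * norm (p x)"
        by (simp_all add: mult_right_mono)
      then show ?thesis using that c1(2)[of x] c2(2)[of x] unfolding X2_def by auto
    qed
    show "x \<in> X1" if "x \<in> X2" "p x = 0" for x
      using that c1(3)[of x] c2(3)[of x] \<open>0 \<in> X1\<close> by (auto simp: X2_def)
  qed
  moreover have "compact (X1 \<union> X2)" using X1(1) X2(1) by (rule compact_Un)
  moreover have "(real_plane \<union> graph_plane A1 \<union> graph_plane A2) \<inter> cball 0 r = X1 \<union> X2"
    by (auto simp: X1_def X2_def)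
  ultimately have "polynomially_convex ((real_plane \<union> graph_plane A1 \<union> graph_plane A2) \<inter> cball 0 r)"
    using \<open>0 \<in> X1\<close> polynomially_convex_iff[of "X1 \<union> X2"] by auto
  moreover have "closed (real_plane \<union> graph_plane A1 \<union> graph_plane A2)"
    using closed_Un[OF closed_real_plane closed12] by (simp add: Un_assoc)
  moreover have "0 \<in> real_plane" by (simp add: real_plane_def)
  ultimately show ?thesis
    unfolding locally_polynomially_convex_at_def using \<open>r > 0\<close> by blast
qed

end
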